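(* Let $\alpha\ge1/2$, $\lambda>0$. Let $X$ be a strictly positive random variable with a density $f_X$ on $(0,\infty)$ such that $f_X/\gamma_{\alpha,\lambda}$ is twice continuously differentiable on $(0,\infty)$, with $\mathbb{E}[X^{\alpha+4}]<\infty$, $\mathbb{E}[X]=\alpha/\lambda$, $J_{st,\gamma}(X)<\infty$, admitting a Stein kernel $\tau_X$ with $\mathbb{E}[(\tau_X(X)-1)^2]<\infty$. Then $$D(X\|\gamma_{\alpha,\lambda})\le\frac12\,\mathbb{E}[(\tau_X(X)-1)^2]\,\log\Big(1+\frac{2}{\lambda}\frac{J_{st,\gamma}(X)}{\mathbb{E}[(\tau_X(X)-1)^2]}\Big).$$
   Context: $\gamma_{\alpha,\lambda}(u)=\frac{\lambda^\alpha}{\Gamma(\alpha)}u^{\alpha-1}e^{-\lambda u}$ on $(0,\infty)$. $D(X\|\gamma_{\alpha,\lambda})=\int_0^\infty f_X\log(f_X/\gamma_{\alpha,\lambda})$. With $\rho_X=(\log f_X)'$, $J_{st,\gamma}(X)=\mathbb{E}\big[X\big(\rho_X(X)-\frac{\alpha-1}{X}+\lambda\big)^2\big]=\int_0^\infty u\frac{(\partial_u(f_X/\gamma_{\alpha,\lambda}))^2}{f_X/\gamma_{\alpha,\lambda}}\gamma_{\alpha,\lambda}(u)du$. A Stein kernel of $X$ is a measurable function $\tau_X:(0,\infty)\to\mathbb{R}$ such that for every $\phi\in C_c^\infty((0,\infty))$, $\mathbb{E}[(\lambda X-\alpha+\tfrac12)\phi(X)]=\mathbb{E}\big[\tau_X(X)\sqrt{X}\,\frac{d}{dx}(\sqrt{x}\phi(x))\big|_{x=X}\big]$.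 *)

theory Defs
  imports "HOL-Analysis.Analysis"
begin

definition gamma_dens :: "real \<Rightarrow> real \<Rightarrow> real \<Rightarrow> real" where
  "gamma_dens \<alpha> lam u = lam powr \<alpha> / Gamma \<alpha> * u powr (\<alpha> - 1) * exp (- lam * u)"

definition expect :: "(real \<Rightarrow> real) \<Rightarrow> (real \<Rightarrow> real) \<Rightarrow> real" where
  "expect f g = (LINT u:{0<..}|lborel. f u * g u)"

definition expect_finite :: "(real \<Rightarrow> real) \<Rightarrow> (real \<Rightarrow> real) \<Rightarrow> bool" where
  "expect_finite f g \<longleftrightarrow> set_integrable lborel {0<..} (\<lambda>u. f u * g u)"

definition rel_entropy_gamma :: "(real \<Rightarrow> real) \<Rightarrow> real \<Rightarrow> real \<Rightarrow> real" where
  "rel_entropy_gamma f \<alpha> lam = (LINT u:{0<..}|lborel. f u * ln (f u / gamma_dens \<alpha> lam u))"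

definition stein_fisher_integrand :: "(real \<Rightarrow> real) \<Rightarrow> real \<Rightarrow> real \<Rightarrow> real \<Rightarrow> real" where
  "stein_fisher_integrand f \<alpha> lam u = u * (deriv f u / f u - (\<alpha> - 1) / u + lam)\<^sup>2"

definition J_st_gamma :: "(real \<Rightarrow> real) \<Rightarrow> real \<Rightarrow> real \<Rightarrow> real" where
  "J_st_gamma f \<alpha> lam = expect f (stein_fisher_integrand f \<alpha> lam)"

definition C2_on :: "real set \<Rightarrow> (real \<Rightarrow> real) \<Rightarrow> bool" where
  "C2_on S h \<longleftrightarrow> (\<exists>h' h''. (\<forall>x\<in>S. (h has_real_derivative h' x) (at x) \<and>
        (h' has_real_derivative h'' x) (at x)) \<and> continuous_on S h'')"

definition test_fun :: "(real \<Rightarrow> real) \<Rightarrow> bool" where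
  "test_fun \<phi> \<longleftrightarrow> (\<forall>k. \<forall>x>0. ((deriv ^^ k) \<phi>) differentiable (at x)) \<and>
     (\<exists>a b. 0 < a \<and> a \<le> b \<and> (\<forall>x. x \<notin> {a..b} \<longrightarrow> \<phi> x = 0))"

definition is_stein_kernel :: "(real \<Rightarrow> real) \<Rightarrow> real \<Rightarrow> real \<Rightarrow> (real \<Rightarrow> real) \<Rightarrow> bool" where
  "is_stein_kernel f \<alpha> lam \<tau> \<longleftrightarrow> \<tau> \<in> borel_measurable borel \<and>
     (\<forall>\<phi>. test_fun \<phi> \<longrightarrow>
        expect f (\<lambda>x. (lam * x - \<alpha> + 1/2) * \<phi> x) =
        expect f (\<lambda>x. \<tau> x * sqrt x * deriv (\<lambda>y. sqrt y * \<phi> y) x))"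

end

theory Submission
  imports Defs
begin

text \<open>
  In the coordinate \<open>y = 2 * sqrt x\<close> the gamma law has potential \<open>V\<close> with
  \<open>V' = (lam * x - (\<alpha> - 1/2)) / sqrt x\<close>, which is convex for \<open>\<alpha> \<ge> 1/2\<close>. Let \<open>T\<close> be the monotone
  map transporting the law of \<open>X\<close> to the gamma law, and \<open>\<theta> = T - y\<close>. The change of variables
  formula gives \<open>D = E[V(y) - V(T) + ln T']\<close>, and convexity bounds \<open>V(y) - V(T)\<close> by
  \<open>- V' * \<theta> - lam/4 * \<theta>\<^sup>2\<close>. The expectation of \<open>- V' * \<theta>\<close> is written as \<open>r\<close> times its
  integration by parts against the density (which produces the score) plus \<open>1 - r\<close> times its
  expression \<open>- E[\<tau> * \<theta>']\<close> through the Stein kernel. Completing the square in the score, and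
  maximising over \<open>T'\<close> pointwise, one obtains for \<open>0 < r \<le> 1\<close>
  \<open>D \<le> r\<^sup>2 * J / lam + (r - 1 - ln r) * S\<close> with \<open>S = E[(\<tau> - 1)\<^sup>2]\<close>,
  and \<open>r = (1 + 2 * J / (lam * S)) powr (- 1/2)\<close> gives the claim. The pointwise step needs \<open>\<tau> \<ge> 0\<close>,
  which can fail only on an initial interval \<open>(0, x0)\<close>; there \<open>- V' * \<theta>\<close> is kept and
  balanced against the singular part of the convexity of \<open>V\<close>.
\<close>

section \<open>Weak antiderivatives on the half-line\<close>

text \<open>The derivatives are existential witnesses instead of iterates of \<open>deriv\<close>,
  so closure under sums, products and affine substitution is a plain induction. Smoothness is
  expressed by asking for every \<open>n\<close>.\<close>

primrec smooth_upto :: "nat \<Rightarrow> real set \<Rightarrow> (real \<Rightarrow> real) \<Rightarrow> bool" where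
  "smooth_upto 0 S f \<longleftrightarrow> True"
| "smooth_upto (Suc n) S f \<longleftrightarrow>
     (\<exists>f'. (\<forall>x\<in>S. (f has_real_derivative f' x) (at x)) \<and> smooth_upto n S f')"

lemma smooth_upto_Suc_imp: "smooth_upto (Suc n) S f \<Longrightarrow> smooth_upto n S f"
  by (induction n arbitrary: f) auto

lemma smooth_upto_cong:
  assumes "smooth_upto n S f" "open S" "\<And>x. x \<in> S \<Longrightarrow> f x = g x"
  shows "smooth_upto n S g"
proof (cases n)
  case (Suc m)
  with assms obtain f' where f': "\<And>x. x \<in> S \<Longrightarrow> (f has_real_derivative f' x) (at x)" "smooth_upto m S f'"
    by auto
  have "(g has_real_derivative f' x) (at x)" if "x \<in> S" for x
    using has_field_derivative_transform_within_open[OF f'(1)[OF that] \<open>open S\<close> that] assms(3) by auto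
  with f'(2) Suc show ?thesis by auto
qed simp

lemma smooth_upto_subset: "smooth_upto n S f \<Longrightarrow> T \<subseteq> S \<Longrightarrow> smooth_upto n T f"
  by (induction n arbitrary: f) (auto dest: subsetD)

lemma smooth_upto_const: "smooth_upto n S (\<lambda>x. c)"
  by (induction n arbitrary: c) (auto intro!: exI[of _ "\<lambda>x. 0"])

lemma smooth_upto_add:
  "smooth_upto n S f \<Longrightarrow> smooth_upto n S g \<Longrightarrow> smooth_upto n S (\<lambda>x. f x + g x)"
proof (induction n arbitrary: f g)
  case (Suc n)
  then obtain f' g' where "\<forall>x\<in>S. (f has_real_derivative f' x) (at x)" "smooth_upto n S f'"
    "\<forall>x\<in>S. (g has_real_derivative g' x) (at x)" "smooth_upto n S g'" by auto
  then show ?case using Suc.IH[of f' g']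
    by (auto intro!: exI[of _ "\<lambda>x. f' x + g' x"] derivative_intros)
qed simp

lemma smooth_upto_mult:
  "smooth_upto n S f \<Longrightarrow> smooth_upto n S g \<Longrightarrow> smooth_upto n S (\<lambda>x. f x * g x)"
proof (induction n arbitrary: f g)
  case (Suc n)
  then obtain f' g' where d: "\<forall>x\<in>S. (f has_real_derivative f' x) (at x)" "smooth_upto n S f'"
    "\<forall>x\<in>S. (g has_real_derivative g' x) (at x)" "smooth_upto n S g'" by auto
  have "smooth_upto n S (\<lambda>x. f' x * g x + f x * g' x)"
    using d Suc smooth_upto_Suc_imp by (intro smooth_upto_add Suc.IH) blast+
  with d show ?case
    unfolding smooth_upto.simps by (intro exI[of _ "\<lambda>x. f' x * g x + f x * g' x"] conjI ballI)
      (auto intro!: derivative_eq_intros)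
qed simp

lemma smooth_upto_affine:
  assumes "smooth_upto n UNIV f"
  shows "smooth_upto n UNIV (\<lambda>x. f (a * x + b))"
  using assms
proof (induction n arbitrary: f)
  case (Suc n)
  then obtain f' where d: "\<And>x. (f has_real_derivative f' x) (at x)" "smooth_upto n UNIV f'" by auto
  have "((\<lambda>x. f (a * x + b)) has_real_derivative f' (a * x + b) * a) (at x)" for x
    by (rule DERIV_chain2[OF d(1)]) (auto intro!: derivative_eq_intros)
  moreover have "smooth_upto n UNIV (\<lambda>x. f' (a * x + b) * a)"
    by (rule smooth_upto_mult[OF Suc.IH[OF d(2)] smooth_upto_const])
  ultimately show ?case
    unfolding smooth_upto.simps by (intro exI[of _ "\<lambda>x. f' (a * x + b) * a"] conjI ballI)
qed simp

lemma smooth_upto_powr: "smooth_upto n {0<..} (\<lambda>x. x powr a)"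
proof (induction n arbitrary: a)
  case (Suc n)
  have "smooth_upto n {0<..} (\<lambda>x. a * x powr (a - 1))"
    by (intro smooth_upto_mult Suc.IH smooth_upto_const)
  then show ?case
    by (auto intro!: exI[of _ "\<lambda>x. a * x powr (a - 1)"] derivative_eq_intros has_real_derivative_powr)
qed simp

lemma smooth_upto_deriv:
  assumes "smooth_upto (Suc n) S f" "open S"
  shows "smooth_upto n S (deriv f)"
proof -
  obtain f' where d: "\<And>x. x \<in> S \<Longrightarrow> (f has_real_derivative f' x) (at x)" "smooth_upto n S f'"
    using assms by auto
  show ?thesis by (rule smooth_upto_cong[OF d(2) \<open>open S\<close>]) (simp add: DERIV_imp_deriv[OF d(1)])
qed

text \<open>Bridge to \<open>test_fun\<close>, which speaks of iterates of \<open>deriv\<close>. On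
  an open set the witnesses agree with \<open>deriv\<close>, and each iterate costs one of
  arbitrarily many orders.\<close>

lemma smooth_upto_differentiable_iterated_deriv:
  assumes "\<And>n. smooth_upto n S f" "open S" "x \<in> S"
  shows "((deriv ^^ k) f) differentiable (at x)"
proof -
  have "smooth_upto n S ((deriv ^^ k) f)" for n k
    by (induction k arbitrary: n) (auto simp: assms simp del: smooth_upto.simps intro!: smooth_upto_deriv)
  from this[of "Suc 0" k] \<open>x \<in> S\<close> show ?thesis
    by (auto simp: real_differentiable_def)
qed

section \<open>Smooth bumps approximating indicators of intervals\<close>

lemma poly_over_exp_tendsto_0: "((\<lambda>x::real. poly p x * exp (- x)) \<longlongrightarrow> 0) at_top"
proof -
  have *: "((\<lambda>x::real. \<Sum>i\<le>degree p. coeff p i * (x ^ i / exp x)) \<longlongrightarrow> (\<Sum>i\<le>degree p. coeff p i * 0)) at_top"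
    by (intro tendsto_intros tendsto_power_div_exp_0)
  show ?thesis
    using * by (simp add: poly_altdef sum_distrib_right exp_minus divide_inverse mult.assoc)
qed

text \<open>For \<open>p = 1\<close> this is the classical \<open>exp (- 1/x)\<close> glued to zero.
  The polynomial in \<open>1/x\<close> makes the family closed under differentiation, so smoothness
  is one induction over all polynomials.\<close>

definition flat_fun :: "real poly \<Rightarrow> real \<Rightarrow> real" where
  "flat_fun p x = (if x > 0 then poly p (inverse x) * exp (- inverse x) else 0)"

lemma flat_fun_has_derivative:
  "(flat_fun p has_real_derivative flat_fun ([:0, 0, 1:] * (p - pderiv p)) x) (at x)"
proof -
  consider "x > 0" | "x < 0" | "x = 0" by linarith
  then show ?thesis
  proof cases
    case 1
    have "((\<lambda>x. poly p (inverse x) * exp (- inverse x)) has_real_derivative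
        flat_fun ([:0, 0, 1:] * (p - pderiv p)) x) (at x)"
      using 1 by (auto intro!: derivative_eq_intros DERIV_chain2[OF poly_DERIV]
          simp: flat_fun_def field_simps power2_eq_square)
    then show ?thesis
      by (rule has_field_derivative_transform_within_open[where S = "{0<..}"])
        (use 1 in \<open>auto simp: flat_fun_def\<close>)
  next
    case 2
    have "((\<lambda>x. 0) has_real_derivative flat_fun ([:0, 0, 1:] * (p - pderiv p)) x) (at x)"
      using 2 by (auto simp: flat_fun_def)
    then show ?thesis
      by (rule has_field_derivative_transform_within_open[where S = "{..<0}"])
        (use 2 in \<open>auto simp: flat_fun_def\<close>)
  next
    case 3
    \<comment> \<open>From the right, the difference quotient at 0 is again a polynomial in
      \<open>1/h\<close> times \<open>exp (- 1/h)\<close>; the exponential decay wins.\<close>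
    have "((\<lambda>h. flat_fun p h / h) \<longlongrightarrow> 0) (at_right 0)"
    proof (rule Lim_transform_eventually)
      show "((\<lambda>h. poly ([:0, 1:] * p) (inverse h) * exp (- inverse h)) \<longlongrightarrow> 0) (at_right (0::real))"
        by (rule filterlim_compose[OF poly_over_exp_tendsto_0 filterlim_inverse_at_top_right])
      show "\<forall>\<^sub>F h in at_right 0. poly ([:0, 1:] * p) (inverse h) * exp (- inverse h) = flat_fun p h / h"
        using eventually_at_right_less[of 0] by eventually_elim (auto simp: flat_fun_def field_simps)
    qed
    moreover have "((\<lambda>h. flat_fun p h / h) \<longlongrightarrow> 0) (at_left 0)"
    proof (rule Lim_transform_eventually)
      show "\<forall>\<^sub>F h in at_left 0. 0 = flat_fun p h / h"
        using eventually_at_left_field[of _ "0::real"] by (auto simp: flat_fun_def intro!: exI[of _ "-1"])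
    qed simp
    ultimately have "((\<lambda>h. flat_fun p h / h) \<longlongrightarrow> 0) (at 0)"
      by (simp add: filterlim_at_split)
    then show ?thesis using 3 by (simp add: DERIV_def flat_fun_def)
  qed
qed

lemma smooth_upto_flat_fun: "smooth_upto n S (flat_fun p)"
  by (induction n arbitrary: p) (auto intro!: flat_fun_has_derivative exI)

text \<open>The arguments are \<open>Suc k\<close> times \<open>x - p\<close> and
  \<open>Suc k\<close> times \<open>q - x\<close>, expanded into the form that
  \<open>smooth_upto_affine\<close> expects. The factor \<open>Suc k\<close> pushes the bump towards
  the indicator of the open interval.\<close>

definition bump :: "real \<Rightarrow> real \<Rightarrow> nat \<Rightarrow> real \<Rightarrow> real" where
  "bump p q k x = flat_fun 1 (real (Suc k) * x + - real (Suc k) * p) *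
     flat_fun 1 (- real (Suc k) * x + real (Suc k) * q)"

lemma smooth_upto_bump: "smooth_upto n UNIV (bump p q k)"
  unfolding bump_def[abs_def] by (intro smooth_upto_mult smooth_upto_affine[OF smooth_upto_flat_fun])

lemma flat_fun_1_bounds: "0 \<le> flat_fun 1 x" "flat_fun 1 x \<le> 1"
  by (auto simp: flat_fun_def)

lemma bump_bounds: "0 \<le> bump p q k x" "bump p q k x \<le> 1"
  unfolding bump_def by (auto intro!: mult_nonneg_nonneg mult_le_one flat_fun_1_bounds)

lemma bump_eq_0: "x \<notin> {p<..<q} \<Longrightarrow> bump p q k x = 0"
proof -
  have "real (Suc k) * x + - real (Suc k) * p = real (Suc k) * (x - p)"
    "- real (Suc k) * x + real (Suc k) * q = real (Suc k) * (q - x)"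
    by (simp_all add: algebra_simps)
  then show "x \<notin> {p<..<q} \<Longrightarrow> bump p q k x = 0"
    unfolding bump_def flat_fun_def by (auto simp: zero_less_mult_iff)
qed

lemma bump_tendsto_indicator: "(\<lambda>k. bump p q k x) \<longlonglongrightarrow> indicator {p<..<q} x"
proof (cases "x \<in> {p<..<q}")
  case True
  have lim: "(\<lambda>k. flat_fun 1 (real (Suc k) * t)) \<longlonglongrightarrow> 1" if "t > 0" for t
  proof -
    have "filterlim (\<lambda>k. t * real (Suc k)) at_top sequentially"
      by (rule filterlim_tendsto_pos_mult_at_top[OF tendsto_const that])
        (use filterlim_Suc filterlim_real_sequentially in \<open>blast intro: filterlim_compose\<close>)
    then have "(\<lambda>k. exp (- inverse (t * real (Suc k)))) \<longlonglongrightarrow> exp (- 0)"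
      by (intro tendsto_intros tendsto_inverse_0_at_top)
    then show ?thesis using that by (simp add: flat_fun_def mult.commute del: of_nat_Suc)
  qed
  have "(\<lambda>k. flat_fun 1 (real (Suc k) * (x - p)) * flat_fun 1 (real (Suc k) * (q - x))) \<longlonglongrightarrow> 1 * 1"
    using True by (intro tendsto_mult lim) auto
  with True show ?thesis by (simp add: bump_def algebra_simps del: of_nat_Suc)
qed (simp add: bump_eq_0)

lemma bump_continuous: "continuous_on S (bump p q k)"
  using smooth_upto_bump[of "Suc 0" p q k]
  by (auto intro!: continuous_at_imp_continuous_on intro: DERIV_isCont)

section \<open>Antiderivatives and a compact exhaustion of the half-line\<close>

lemma antiderivative_on_pos:
  fixes g :: "real \<Rightarrow> real"
  assumes "continuous_on {0<..} g"
  obtains G where "\<And>x. x > 0 \<Longrightarrow> (G has_real_derivative g x) (at x)"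
  using einterval_antiderivative[of 0 "\<infinity>" g] assms
  by (auto simp: has_real_derivative_iff_has_vector_derivative einterval_def zero_ereal_def
      continuous_on_eq_continuous_at)

text \<open>The offset \<open>m\<close> lets the exhaustion start with an interval as large as
  needed.\<close>

lemma incseq_reciprocal_Icc: "incseq (\<lambda>n. {inverse (real (Suc (n + m)))..real (Suc (n + m))})"
proof (rule incseq_SucI)
  fix n
  have "inverse (real (Suc (Suc n + m))) \<le> inverse (real (Suc (n + m)))"
    by (intro le_imp_inverse_le) auto
  then show "{inverse (real (Suc (n + m)))..real (Suc (n + m))} \<subseteq> {inverse (real (Suc (Suc n + m)))..real (Suc (Suc n + m))}"
    by auto
qed

lemma reciprocal_Icc_subset: "{inverse (real (Suc n))..real (Suc n)} \<subseteq> {0<..}"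
  using order_less_le_trans[of 0 "inverse (real (Suc n))"] by auto

lemma UN_reciprocal_Icc: "(\<Union>n. {inverse (real (Suc (n + m)))..real (Suc (n + m))}) = {0<..}"
proof (intro equalityI subsetI)
  fix x :: real assume "x \<in> {0<..}"
  then have "x > 0" by simp
  obtain n where n: "real n \<ge> max x (inverse x)" using real_arch_simple by blast
  then have "inverse x \<le> real (Suc (n + m))" "x \<le> real (Suc (n + m))" by auto
  moreover from this have "inverse (real (Suc (n + m))) \<le> x"
    using \<open>x > 0\<close> by (metis inverse_inverse_eq inverse_positive_iff_positive le_imp_inverse_le)
  ultimately show "x \<in> (\<Union>n. {inverse (real (Suc (n + m)))..real (Suc (n + m))})" by auto
qed (use reciprocal_Icc_subset in blast)

section \<open>The du Bois-Reymond lemma\<close>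

text \<open>After extension by zero, positive and negative part have the same integral over every
  half-line. They are therefore densities of the same measure and agree almost everywhere, which is
  possible only where both vanish.\<close>

lemma AE_eq_0_if_interval_integrals_eq_0:
  fixes u :: "real \<Rightarrow> real"
  assumes u: "set_integrable lborel {a..b} u"
    and zero: "\<And>p q. a \<le> p \<Longrightarrow> p < q \<Longrightarrow> q \<le> b \<Longrightarrow> (LINT x:{p<..<q}|lborel. u x) = 0"
  shows "AE x in lborel. x \<in> {a..b} \<longrightarrow> u x = 0"
proof -
  define v where "v x = indicator {a..b} x * u x" for x
  have v: "integrable lborel v"
    using u by (simp add: set_integrable_def v_def[abs_def])
  then have [measurable]: "v \<in> borel_measurable borel" by simp
  have z: "(LINT x|lborel. v x * indicator {t<..} x) = 0" for t
  proof -
    have "(LINT x|lborel. v x * indicator {t<..} x) = (LINT x|lborel. u x * indicator {max a t<..<b} x)"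
    proof (rule integral_cong_AE)
      have "AE x in lborel. x \<noteq> a \<and> x \<noteq> b"
        by (intro AE_conjI AE_lborel_singleton)
      then show "AE x in lborel. v x * indicator {t<..} x = u x * indicator {max a t<..<b} x"
        by eventually_elim (auto simp: v_def indicator_def)
      have "(\<lambda>x. u x * indicator {max a t<..<b} x) = (\<lambda>x. v x * indicator {max a t<..<b} x)"
        by (auto simp: v_def indicator_def fun_eq_iff)
      then show "(\<lambda>x. u x * indicator {max a t<..<b} x) \<in> borel_measurable lborel" by simp
    qed simp
    also have "\<dots> = 0"
    proof (cases "max a t < b")
      case True
      then show ?thesis using zero[of "max a t" b] by (simp add: set_lebesgue_integral_def mult.commute)
    next
      case False
      then have "{max a t<..<b} = {}" by auto
      then show ?thesis by simp
    qed
    finally show ?thesis .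
  qed
  have int: "integrable lborel (\<lambda>x. max 0 (v x) * indicator {t<..} x)"
    "integrable lborel (\<lambda>x. max 0 (- v x) * indicator {t<..} x)" for t
    using v by (auto intro!: integrable_real_mult_indicator)
  have eq: "emeasure (density lborel (\<lambda>x. ennreal (max 0 (f x)))) {t<..} =
      ennreal (LINT x|lborel. max 0 (f x) * indicator {t<..} x)"
    if [measurable]: "f \<in> borel_measurable borel" and "integrable lborel (\<lambda>x. max 0 (f x) * indicator {t<..} x)"
    for f :: "real \<Rightarrow> real" and t
  proof -
    have "emeasure (density lborel (\<lambda>x. ennreal (max 0 (f x)))) {t<..} =
        (\<integral>\<^sup>+x. ennreal (max 0 (f x)) * indicator {t<..} x \<partial>lborel)"
      by (rule emeasure_density) simp_all
    also have "\<dots> = (\<integral>\<^sup>+x. ennreal (max 0 (f x) * indicator {t<..} x) \<partial>lborel)"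
      by (intro nn_integral_cong) (auto simp: indicator_def)
    also have "\<dots> = ennreal (LINT x|lborel. max 0 (f x) * indicator {t<..} x)"
      using that by (intro nn_integral_eq_integral) auto
    finally show ?thesis .
  qed
  have same: "(LINT x|lborel. max 0 (v x) * indicator {t<..} x) = (LINT x|lborel. max 0 (- v x) * indicator {t<..} x)" for t
  proof -
    have "(LINT x|lborel. max 0 (v x) * indicator {t<..} x) - (LINT x|lborel. max 0 (- v x) * indicator {t<..} x)
      = (LINT x|lborel. max 0 (v x) * indicator {t<..} x - max 0 (- v x) * indicator {t<..} x)"
      by (rule Bochner_Integration.integral_diff[symmetric]) (rule int)+
    also have "\<dots> = (LINT x|lborel. v x * indicator {t<..} x)"
      by (intro Bochner_Integration.integral_cong) (auto simp: indicator_def)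
    finally show ?thesis using z by simp
  qed
  have "density lborel (\<lambda>x. ennreal (max 0 (v x))) = density lborel (\<lambda>x. ennreal (max 0 (- v x)))"
    by (rule measure_eqI_lessThan) (simp_all add: eq int same)
  then have "AE x in lborel. ennreal (max 0 (v x)) = ennreal (max 0 (- v x))"
    by (rule sigma_finite_measure.density_unique[OF lborel.sigma_finite_measure_axioms, rotated 2]) simp_all
  then show ?thesis
    by eventually_elim (auto simp: v_def max_def split: if_splits)
qed

text \<open>Subtracting a classical antiderivative \<open>G0\<close> of \<open>g\<close> leaves a
  function \<open>v\<close> with weak derivative zero. Testing \<open>v\<close> with differences of
  normalised bumps shows that its mean over an interval does not depend on the interval, so
  \<open>v\<close> is almost everywhere constant.\<close>

lemma antiderivative_if_weak_antiderivative:
  fixes w g :: "real \<Rightarrow> real"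
  assumes w: "\<And>a b. 0 < a \<Longrightarrow> set_integrable lborel {a..b} w"
    and g: "continuous_on {0<..} g"
    and weak: "\<And>\<psi> \<psi>' a b. 0 < a \<Longrightarrow> a < b \<Longrightarrow> (\<And>x. (\<psi> has_real_derivative \<psi>' x) (at x)) \<Longrightarrow>
       (\<And>n. smooth_upto n UNIV \<psi>) \<Longrightarrow> (\<And>x. x \<notin> {a..b} \<Longrightarrow> \<psi> x = 0 \<and> \<psi>' x = 0) \<Longrightarrow>
       (LINT x:{a..b}|lborel. g x * \<psi> x) = - (LINT x:{a..b}|lborel. w x * \<psi>' x)"
  obtains G where "\<And>x. x > 0 \<Longrightarrow> (G has_real_derivative g x) (at x)"
    "AE x in lborel. x > 0 \<longrightarrow> w x = G x"
proof -
  obtain G0 where G0: "\<And>x. x > 0 \<Longrightarrow> (G0 has_real_derivative g x) (at x)"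
    using antiderivative_on_pos[OF g] by blast
  have G0_cont: "continuous_on S G0" if "S \<subseteq> {0<..}" for S
    using that G0 by (intro continuous_at_imp_continuous_on) (auto intro: DERIV_isCont)
  define v where "v x = w x - G0 x" for x
  have v: "set_integrable lborel {a..b} v" if "0 < a" for a b
    unfolding v_def[abs_def] using that
    by (intro set_integral_diff w borel_integrable_atLeastAtMost' G0_cont) auto
  have orth: "(LINT x:{a..b}|lborel. v x * \<psi>' x) = 0"
    if ab: "0 < a" "a < b" and d: "\<And>x. (\<psi> has_real_derivative \<psi>' x) (at x)"
      and s: "\<And>n. smooth_upto n UNIV \<psi>" and supp: "\<And>x. x \<notin> {a<..<b} \<Longrightarrow> \<psi> x = 0 \<and> \<psi>' x = 0"
      and cont: "continuous_on UNIV \<psi>'"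
      and bdd: "\<And>x. \<bar>\<psi>' x\<bar> \<le> B" for \<psi> \<psi>' a b B
  proof -
    have wi: "set_integrable lborel {a..b} (\<lambda>x. w x * \<psi>' x)"
    proof (rule set_integrable_bound)
      show "set_integrable lborel {a..b} (\<lambda>x. B * w x)" using w[OF ab(1)] by simp
      have [measurable]: "\<psi>' \<in> borel_measurable borel" using cont by (rule borel_measurable_continuous_onI)
      have "(\<lambda>x. indicator {a..b} x *\<^sub>R w x) \<in> borel_measurable lborel"
        using w[OF ab(1), of b] by (simp add: set_integrable_def)
      then have "(\<lambda>x. (indicator {a..b} x *\<^sub>R w x) * \<psi>' x) \<in> borel_measurable lborel" by measurable
      then show "set_borel_measurable lborel {a..b} (\<lambda>x. w x * \<psi>' x)"
        by (simp add: set_borel_measurable_def mult.assoc)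
      have "\<bar>B\<bar> = B" using bdd[of 0] by linarith
      then show "AE x in lborel. x \<in> {a..b} \<longrightarrow> norm (w x * \<psi>' x) \<le> norm (B * w x)"
        using bdd by (auto simp: abs_mult mult.commute intro!: mult_right_mono)
    qed
    have \<psi>_cont: "continuous_on S \<psi>" for S
      by (intro continuous_at_imp_continuous_on ballI DERIV_isCont[OF d])
    have gi: "set_integrable lborel {a..b} (\<lambda>x. g x * \<psi> x)"
      using ab by (intro borel_integrable_atLeastAtMost' continuous_intros \<psi>_cont
          continuous_on_subset[OF g]) auto
    have Gi: "set_integrable lborel {a..b} (\<lambda>x. G0 x * \<psi>' x)"
      using ab cont by (intro borel_integrable_atLeastAtMost' continuous_intros G0_cont)
        (auto intro: continuous_on_subset)
    have "(LINT x:{a..b}|lborel. g x * \<psi> x + G0 x * \<psi>' x) = G0 b * \<psi> b - G0 a * \<psi> a"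
      unfolding set_lebesgue_integral_def
    proof (rule integral_FTC_atLeastAtMost)
      show "((\<lambda>x. G0 x * \<psi> x) has_vector_derivative g x * \<psi> x + G0 x * \<psi>' x) (at x within {a..b})"
        if "a \<le> x" "x \<le> b" for x
        unfolding has_real_derivative_iff_has_vector_derivative[symmetric] using that ab
        by (auto intro!: derivative_eq_intros has_field_derivative_at_within[OF G0]
            has_field_derivative_at_within[OF d])
      show "continuous_on {a..b} (\<lambda>x. g x * \<psi> x + G0 x * \<psi>' x)"
        using ab by (intro continuous_intros G0_cont \<psi>_cont continuous_on_subset[OF g]
            continuous_on_subset[OF cont]) auto
    qed (use ab in auto)
    also have "\<dots> = 0" using supp[of a] supp[of b] by simp
    finally have "(LINT x:{a..b}|lborel. g x * \<psi> x) + (LINT x:{a..b}|lborel. G0 x * \<psi>' x) = 0"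
      using gi Gi by simp
    moreover have "(LINT x:{a..b}|lborel. g x * \<psi> x) = - (LINT x:{a..b}|lborel. w x * \<psi>' x)"
      using supp by (intro weak ab d s) auto
    ultimately show ?thesis using wi Gi by (simp add: v_def left_diff_distrib)
  qed
  have cross: "(LINT x:{a..b}|lborel. v x * bump p q k x) * (LINT x:{a..b}|lborel. bump p' q' k x) =
      (LINT x:{a..b}|lborel. v x * bump p' q' k x) * (LINT x:{a..b}|lborel. bump p q k x)"
    if ab: "0 < a" "a < p" "p < q" "q < b" "a < p'" "p' < q'" "q' < b" for a b p q p' q' k
  proof -
    define I I' where "I = (LINT x:{a..b}|lborel. bump p q k x)" and "I' = (LINT x:{a..b}|lborel. bump p' q' k x)"
    \<comment> \<open>The weights make the total integral of \<open>\<psi>'\<close> zero. Its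
      antiderivative vanishing at \<open>a\<close> then vanishes at \<open>b\<close> as well and is
      an admissible test function.\<close>
    define \<psi>' where "\<psi>' x = I' * bump p q k x + (- I) * bump p' q' k x" for x
    have cont: "continuous_on S \<psi>'" for S
      unfolding \<psi>'_def by (intro continuous_intros bump_continuous)
    have supp': "\<psi>' x = 0" if "x \<notin> {a<..<b}" for x
      using that ab bump_eq_0[of x p q k] bump_eq_0[of x p' q' k] by (auto simp: \<psi>'_def)
    have bi: "set_integrable lborel {a..b} (bump p q k)" for p q
      by (intro borel_integrable_atLeastAtMost' bump_continuous)
    have supp0: "(LBINT y:{a..b}. \<psi>' y) = 0"
    proof -
      have "(LBINT y:{a..b}. \<psi>' y) = I' * (LBINT y:{a..b}. bump p q k y) + (- I) * (LBINT y:{a..b}. bump p' q' k y)"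
        unfolding \<psi>'_def
        by (subst set_integral_add) (auto simp only: set_integral_mult_right intro!: set_integrable_mult_right bi)
      then show ?thesis unfolding I_def I'_def by (simp add: mult.commute)
    qed
    have "isCont \<psi>' x" for x
      using cont[of UNIV] by (simp add: continuous_on_eq_continuous_at)
    then obtain \<psi>0 where \<psi>0: "\<And>x. (\<psi>0 has_real_derivative \<psi>' x) (at x)"
      using einterval_antiderivative[of "-\<infinity>" "\<infinity>" \<psi>']
      by (auto simp: has_real_derivative_iff_has_vector_derivative)
    define \<psi> where "\<psi> x = \<psi>0 x - \<psi>0 a" for x
    have d: "(\<psi> has_real_derivative \<psi>' x) (at x)" for x
      unfolding \<psi>_def[abs_def] by (auto intro!: derivative_eq_intros \<psi>0)
    have "(LINT x:{a..b}|lborel. \<psi>' x) = \<psi> b - \<psi> a"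
      unfolding set_lebesgue_integral_def using ab
      by (intro integral_FTC_atLeastAtMost cont)
        (auto simp: has_real_derivative_iff_has_vector_derivative[symmetric] intro!: has_field_derivative_at_within d)
    then have "\<psi> b = 0" using supp0 by (simp add: \<psi>_def)
    have const: "\<psi> x = \<psi> y" if "x \<le> y" "y \<le> a \<or> b \<le> x" for x y
    proof (cases "x = y")
      case False
      with that show ?thesis
        by (intro DERIV_isconst_end[of x y \<psi>, symmetric])
          (auto intro!: continuous_at_imp_continuous_on DERIV_isCont[OF d] d[THEN DERIV_cong] supp')
    qed simp
    have supp: "\<psi> x = 0" if "x \<notin> {a<..<b}" for x
    proof (cases "x \<le> a")
      case True then show ?thesis using const[of x a] by (simp add: \<psi>_def)
    next
      case False
      with that have "b \<le> x" by auto
      then show ?thesis using const[of b x] \<open>\<psi> b = 0\<close> by simp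
    qed
    have smooth: "smooth_upto n UNIV \<psi>" for n
    proof (cases n)
      case (Suc m)
      have "smooth_upto m UNIV \<psi>'"
        unfolding \<psi>'_def[abs_def]
        by (intro smooth_upto_add smooth_upto_mult smooth_upto_const smooth_upto_bump)
      with d Suc show ?thesis by auto
    qed simp
    have bdd: "\<bar>\<psi>' x\<bar> \<le> \<bar>I'\<bar> + \<bar>I\<bar>" for x
    proof -
      have "\<bar>\<psi>' x\<bar> \<le> \<bar>I'\<bar> * \<bar>bump p q k x\<bar> + \<bar>I\<bar> * \<bar>bump p' q' k x\<bar>"
        unfolding \<psi>'_def abs_mult[symmetric] by linarith
      also have "\<dots> \<le> \<bar>I'\<bar> * 1 + \<bar>I\<bar> * 1"
        using bump_bounds by (intro add_mono mult_left_mono) auto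
      finally show ?thesis by simp
    qed
    have "(LINT x:{a..b}|lborel. v x * \<psi>' x) = 0"
      using ab by (intro orth[of a b \<psi> \<psi>' "\<bar>I'\<bar> + \<bar>I\<bar>"] d smooth cont bdd) (auto simp: supp supp')
    moreover have vb: "set_integrable lborel {a..b} (\<lambda>x. v x * bump p q k x)" for p q
    proof (rule set_integrable_bound[OF v[OF ab(1)]])
      have [measurable]: "bump p q k \<in> borel_measurable borel"
        by (intro borel_measurable_continuous_onI bump_continuous)
      have "(\<lambda>x. indicator {a..b} x *\<^sub>R v x) \<in> borel_measurable lborel"
        using v[OF ab(1), of b] by (simp add: set_integrable_def)
      then have "(\<lambda>x. (indicator {a..b} x *\<^sub>R v x) * bump p q k x) \<in> borel_measurable lborel" by measurable
      then show "set_borel_measurable lborel {a..b} (\<lambda>x. v x * bump p q k x)"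
        by (simp add: set_borel_measurable_def mult.assoc)
      show "AE x in lborel. x \<in> {a..b} \<longrightarrow> norm (v x * bump p q k x) \<le> norm (v x)"
        using bump_bounds by (auto simp: abs_mult intro!: mult_left_le)
    qed
    moreover have "v x * \<psi>' x = I' * (v x * bump p q k x) - I * (v x * bump p' q' k x)" for x
      by (simp add: \<psi>'_def algebra_simps)
    ultimately have "I' * (LINT x:{a..b}|lborel. v x * bump p q k x) - I * (LINT x:{a..b}|lborel. v x * bump p' q' k x) = 0"
      by simp
    then show ?thesis by (simp add: I_def I'_def mult.commute)
  qed
  have lim: "(\<lambda>k. LINT x:{a..b}|lborel. u x * bump p q k x) \<longlonglongrightarrow> (LINT x:{p<..<q}|lborel. u x)"
    if "a < p" "p < q" "q < b" and u: "set_integrable lborel {a..b} u" for a b p q u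
  proof -
    have [measurable]: "bump p q k \<in> borel_measurable borel" for k
      by (intro borel_measurable_continuous_onI bump_continuous)
    define u' where "u' x = indicator {a..b} x * u x" for x
    have u'_int: "integrable lborel u'" using u by (simp add: set_integrable_def u'_def[abs_def])
    then have [measurable]: "u' \<in> borel_measurable borel" by simp
    have "(\<lambda>k. LINT x|lborel. u' x * bump p q k x) \<longlonglongrightarrow> (LINT x|lborel. u' x * indicator {p<..<q} x)"
    proof (rule integral_dominated_convergence)
      show "integrable lborel (\<lambda>x. norm (u' x))" using u'_int by simp
      show "AE x in lborel. (\<lambda>k. u' x * bump p q k x) \<longlonglongrightarrow> u' x * indicator {p<..<q} x"
        by (intro AE_I2 tendsto_intros bump_tendsto_indicator)
      show "AE x in lborel. norm (u' x * bump p q k x) \<le> norm (u' x)" for k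
        using bump_bounds by (auto simp: abs_mult intro!: mult_left_le)
    qed simp_all
    moreover have "u' x * indicator {p<..<q} x = indicator {p<..<q} x *\<^sub>R u x" for x
      using that by (auto simp: u'_def indicator_def)
    moreover have "u' x * bump p q k x = indicator {a..b} x *\<^sub>R (u x * bump p q k x)" for x k
      by (simp add: u'_def)
    ultimately show ?thesis by (simp add: set_lebesgue_integral_def)
  qed
  \<comment> \<open>The interval has length 1, so this is the mean of \<open>v\<close> over it: the
    candidate for the constant.\<close>
  define C where "C = (LINT x:{1<..<2}|lborel. v x)"
  have mean: "(LINT x:{p<..<q}|lborel. v x - C) = 0" if "0 < p" "p < q" for p q
  proof -
    \<comment> \<open>One compact interval containing both the given interval and the reference
      interval in its interior.\<close>
    define a b where "a = min 1 p / 2" and "b = max 2 q + 1"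
    have ab: "0 < a" "a < p" "a < 1" "q < b" "2 < b" using that by (auto simp: a_def b_def)
    have one: "set_integrable lborel {a..b} (\<lambda>x. 1::real)"
      by (intro borel_integrable_atLeastAtMost') simp
    note L = lim[OF ab(2) that(2) ab(4)] lim[OF ab(3) _ ab(5)]
    have "(\<lambda>k. (LINT x:{a..b}|lborel. v x * bump p q k x) * (LINT x:{a..b}|lborel. 1 * bump 1 2 k x))
      \<longlonglongrightarrow> (LINT x:{p<..<q}|lborel. v x) * (LINT x:{1<..<2::real}|lborel. 1)"
      by (intro tendsto_mult L one v ab(1)) simp_all
    moreover have "(\<lambda>k. (LINT x:{a..b}|lborel. v x * bump 1 2 k x) * (LINT x:{a..b}|lborel. 1 * bump p q k x))
      \<longlonglongrightarrow> C * (LINT x:{p<..<q}|lborel. 1)"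
      unfolding C_def by (intro tendsto_mult L one v ab(1)) simp_all
    ultimately have "(LINT x:{p<..<q}|lborel. v x) * (LINT x:{1<..<2::real}|lborel. 1) = C * (LINT x:{p<..<q}|lborel. 1)"
      using cross[of a p q b 1 2] ab that by (intro LIMSEQ_unique) (auto simp: algebra_simps)
    moreover have "set_integrable lborel {p<..<q} v"
      by (rule set_integrable_subset[OF v[OF ab(1), of b]]) (use ab in auto)
    moreover have "set_integrable lborel {p<..<q} (\<lambda>_. C)"
      by (rule set_integrable_subset[OF borel_integrable_atLeastAtMost'[of a b]]) (use ab in auto)
    ultimately show ?thesis using that
      by (simp add: set_integral_const)
  qed
  have "AE x in lborel. x \<in> {inverse (real (Suc n))..real (Suc n)} \<longrightarrow> v x - C = 0" for n
  proof (rule AE_eq_0_if_interval_integrals_eq_0)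
    show "set_integrable lborel {inverse (real (Suc n))..real (Suc n)} (\<lambda>x. v x - C)"
      by (intro set_integral_diff v borel_integrable_atLeastAtMost') auto
    show "(LINT x:{p<..<q}|lborel. v x - C) = 0" if "inverse (real (Suc n)) \<le> p" "p < q" for p q
    proof (rule mean)
      have "0 < inverse (real (Suc n))" by simp
      then show "0 < p" using that by linarith
    qed fact
  qed
  then have "AE x in lborel. \<forall>n. x \<in> {inverse (real (Suc n))..real (Suc n)} \<longrightarrow> v x - C = 0"
    by (subst AE_all_countable) blast
  then have "AE x in lborel. x > 0 \<longrightarrow> w x = G0 x + C"
  proof (eventually_elim, intro impI)
    fix x :: real assume *: "\<forall>n. x \<in> {inverse (real (Suc n))..real (Suc n)} \<longrightarrow> v x - C = 0" and "x > 0"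
    then have "x \<in> (\<Union>n. {inverse (real (Suc (n + 0)))..real (Suc (n + 0))})"
      unfolding UN_reciprocal_Icc by simp
    then show "w x = G0 x + C" using * by (auto simp: v_def)
  qed
  moreover have "((\<lambda>x. G0 x + C) has_real_derivative g x) (at x)" if "x > 0" for x
    using G0[OF that] by (auto intro!: derivative_eq_intros)
  ultimately show ?thesis using that by blast
qed

section \<open>Pointwise inequalities and monotone transport\<close>

text \<open>The right side is the maximum of the left over \<open>t\<close>, attained at
  \<open>t = 1/P\<close>.\<close>

lemma ln_minus_linear_le:
  fixes t P :: real
  assumes "t > 0" "P > 0"
  shows "ln t - P * (t - 1) \<le> P - 1 - ln P"
  using ln_le_minus_one[of "P * t"] assms by (simp add: ln_mult algebra_simps)

text \<open>With \<open>q = 1 - r\<close>, the difference \<open>F q\<close> of the two sides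
  vanishes at 0. It is nondecreasing because \<open>s \<ge> -1\<close> gives
  \<open>1 - q \<le> 1 + q * s\<close>. The application takes \<open>s = \<tau> - 1\<close>, which
  is why a nonnegative kernel is required.\<close>

lemma minus_ln_le_square:
  fixes r s :: real
  assumes r: "0 < r" "r \<le> 1" and s: "-1 \<le> s"
  shows "(1 - r) * s - ln (1 + (1 - r) * s) \<le> (r - 1 - ln r) * s\<^sup>2"
proof -
  define F where "F q = s\<^sup>2 * (- q - ln (1 - q)) - (q * s - ln (1 + q * s))" for q
  have pos: "1 - q \<le> 1 + q * s" if "0 \<le> q" for q
    using mult_left_mono[OF s that] by simp
  have "F 0 \<le> F (1 - r)"
  proof (rule DERIV_nonneg_imp_nondecreasing[where f = F])
    fix q assume q: "0 \<le> q" "q \<le> 1 - r"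
    then have pq: "0 < 1 - q" "0 < 1 + q * s" using r pos[of q] by linarith+
    have "(F has_real_derivative s\<^sup>2 * (-1 + 1 / (1 - q)) - (s - s / (1 + q * s))) (at q)"
      unfolding F_def using pq by (auto intro!: derivative_eq_intros simp: divide_simps)
    moreover have "s\<^sup>2 * (-1 + 1 / (1 - q)) - (s - s / (1 + q * s)) = q * s\<^sup>2 * (1 / (1 - q) - 1 / (1 + q * s))"
      using pq by (simp add: divide_simps power2_eq_square) (simp add: algebra_simps)
    moreover have "0 \<le> q * s\<^sup>2 * (1 / (1 - q) - 1 / (1 + q * s))"
      using q pq pos[of q] by (intro mult_nonneg_nonneg) (auto intro: divide_left_mono)
    ultimately show "\<exists>y. (F has_real_derivative y) (at q) \<and> 0 \<le> y" by metis
  qed (use r in auto)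
  then show ?thesis by (simp add: F_def algebra_simps)
qed

text \<open>Concavity of \<open>ln\<close>: \<open>P\<close> is the mean of \<open>r\<close> and 1
  with weights \<open>1 - m\<close> and \<open>m\<close>, so \<open>ln P\<close> is at least
  \<open>(1 - m) * ln r\<close>, while \<open>P - 1\<close> equals
  \<open>(r - 1) * (1 - m)\<close>.\<close>

lemma convex_combination_minus_ln_le:
  fixes r m :: real
  assumes r: "0 < r" "r \<le> 1" and m: "0 \<le> m" "m \<le> 1"
  defines "P \<equiv> r + (1 - r) * m"
  shows "P - 1 - ln P \<le> (r - 1 - ln r) * (1 - m)"
proof -
  have P: "P > 0" using r m by (simp add: P_def add_pos_nonneg)
  have 1: "ln r - ln P \<le> (r - P) / P" "ln 1 - ln P \<le> (1 - P) / P"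
    using ln_le_minus_one[of "r / P"] ln_le_minus_one[of "1 / P"] P r
    by (simp_all add: ln_div diff_divide_distrib)
  have "(1 - m) * (ln r - ln P) + m * (ln 1 - ln P) \<le> (1 - m) * ((r - P) / P) + m * ((1 - P) / P)"
    using m 1 by (intro add_mono mult_left_mono) auto
  also have "\<dots> = ((1 - m) * r + m - P) / P"
    by (simp add: add_divide_distrib[symmetric]) (simp add: algebra_simps)
  also have "(1 - m) * r + m - P = 0" by (simp add: P_def algebra_simps)
  finally have "(1 - m) * ln r \<le> ln P" by (simp add: algebra_simps)
  then show ?thesis by (simp add: P_def algebra_simps)
qed

section \<open>The gamma density\<close>

lemma gamma_dens_pos:
  assumes "\<alpha> > 0" "lam > 0" "u > 0"
  shows "gamma_dens \<alpha> lam u > 0"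
  using assms by (simp add: gamma_dens_def Gamma_real_pos)

lemma gamma_dens_has_derivative:
  assumes "u > 0"
  shows "(gamma_dens \<alpha> lam has_real_derivative gamma_dens \<alpha> lam u * ((\<alpha> - 1) / u - lam)) (at u)"
proof -
  define C where "C = lam powr \<alpha> / Gamma \<alpha>"
  have "((\<lambda>u. u powr (\<alpha> - 1)) has_real_derivative (\<alpha> - 1) * u powr (\<alpha> - 1) / u) (at u)"
    using has_real_derivative_powr[OF assms, of "\<alpha> - 1"] assms by (simp add: powr_diff power2_eq_square)
  moreover have "((\<lambda>u. exp (- lam * u)) has_real_derivative exp (- lam * u) * - lam) (at u)"
    by (auto intro!: derivative_eq_intros)
  ultimately have "((\<lambda>u. C * u powr (\<alpha> - 1) * exp (- lam * u)) has_real_derivative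
      C * ((\<alpha> - 1) * u powr (\<alpha> - 1) / u) * exp (- lam * u) + exp (- lam * u) * - lam * (C * u powr (\<alpha> - 1))) (at u)"
    by (intro DERIV_mult DERIV_cmult)
  moreover have "C * ((\<alpha> - 1) * u powr (\<alpha> - 1) / u) * exp (- lam * u) + exp (- lam * u) * - lam * (C * u powr (\<alpha> - 1))
      = gamma_dens \<alpha> lam u * ((\<alpha> - 1) / u - lam)"
    unfolding gamma_dens_def C_def[symmetric] by (simp add: algebra_simps)
  ultimately show ?thesis by (simp add: gamma_dens_def[abs_def] C_def)
qed

lemma has_bochner_integral_gamma_dens:
  assumes "\<alpha> > 0" "lam > 0"
  shows "has_bochner_integral lborel (\<lambda>u. indicator {0<..} u * gamma_dens \<alpha> lam u) 1"
proof -
  have Gamma0: "Gamma \<alpha> \<noteq> 0"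
    using Gamma_real_pos[OF assms(1)] by linarith
  have "has_bochner_integral lborel (\<lambda>t. indicator {0..} t * t powr (\<alpha> - 1) / exp t) (Gamma \<alpha>)"
    using Gamma_conv_nn_integral_real[OF \<open>\<alpha> > 0\<close>] assms
    by (intro has_bochner_integral_nn_integral) (auto intro!: Gamma_real_nonneg)
  then have "has_bochner_integral lborel (\<lambda>x. indicator {0..} (0 + lam * x) * (0 + lam * x) powr (\<alpha> - 1) / exp (0 + lam * x))
      (Gamma \<alpha> /\<^sub>R \<bar>lam\<bar>)"
    using assms by (subst (asm) lborel_has_bochner_integral_real_affine_iff[of lam _ _ 0]) auto
  then have "has_bochner_integral lborel (\<lambda>x. lam / Gamma \<alpha> * (indicator {0..} (0 + lam * x) * (0 + lam * x) powr (\<alpha> - 1) / exp (0 + lam * x)))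
      (lam / Gamma \<alpha> * (Gamma \<alpha> /\<^sub>R \<bar>lam\<bar>))"
    by (rule has_bochner_integral_mult_right)
  moreover have "lam / Gamma \<alpha> * (Gamma \<alpha> /\<^sub>R \<bar>lam\<bar>) = 1"
    using assms Gamma0 by simp
  moreover have "lam / Gamma \<alpha> * (indicator {0..} (0 + lam * x) * (0 + lam * x) powr (\<alpha> - 1) / exp (0 + lam * x))
      = indicator {0<..} x * gamma_dens \<alpha> lam x" for x
    \<comment> \<open>At \<open>x = 0\<close> the two indicators differ, but
      \<open>0 powr (\<alpha> - 1)\<close> is 0 by convention for every exponent.\<close>
    using assms Gamma0 by (cases "x = 0")
      (auto simp: indicator_def gamma_dens_def zero_le_mult_iff powr_mult powr_diff exp_minus field_simps)
  ultimately show ?thesis by simp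
qed

lemma gamma_dens_measurable [measurable]: "gamma_dens \<alpha> lam \<in> borel_measurable borel"
  unfolding gamma_dens_def[abs_def] by measurable

lemma set_integrable_gamma_dens:
  assumes "\<alpha> > 0" "lam > 0"
  shows "set_integrable lborel {0<..} (gamma_dens \<alpha> lam)" "(LINT u:{0<..}|lborel. gamma_dens \<alpha> lam u) = 1"
  using has_bochner_integral_gamma_dens[OF assms]
  by (auto simp: set_integrable_def set_lebesgue_integral_def has_bochner_integral_iff)

section \<open>Monotone transport to a conditioned density\<close>

lemma set_integral_FTC:
  fixes F :: "real \<Rightarrow> real"
  assumes "a \<le> b" "\<And>x. a \<le> x \<Longrightarrow> x \<le> b \<Longrightarrow> (F has_real_derivative f x) (at x)" "continuous_on {a..b} f"
  shows "(LINT x:{a..b}|lborel. f x) = F b - F a"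
  unfolding set_lebesgue_integral_def using assms
  by (intro integral_FTC_atLeastAtMost)
    (auto simp: has_real_derivative_iff_has_vector_derivative intro: has_vector_derivative_at_within)

lemma set_integral_mono_subset:
  fixes f :: "'a \<Rightarrow> real"
  assumes "set_integrable M B f" "A \<in> sets M" "A \<subseteq> B" "\<And>x. x \<in> B \<Longrightarrow> f x \<ge> 0"
  shows "(LINT x:A|M. f x) \<le> (LINT x:B|M. f x)"
  unfolding set_lebesgue_integral_def
proof (rule integral_mono)
  show "integrable M (\<lambda>x. indicator A x *\<^sub>R f x)" "integrable M (\<lambda>x. indicator B x *\<^sub>R f x)"
    using set_integrable_subset[OF assms(1-3)] assms(1) by (auto simp: set_integrable_def)
qed (use assms(3,4) in \<open>auto simp: indicator_def\<close>)

text \<open>\<open>U x\<close> is the point of \<open>{c..d}\<close> for which the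
  \<open>g\<close>-mass of \<open>{c..U x}\<close> is \<open>Z\<close> times the
  \<open>f\<close>-mass up to \<open>x\<close>. It exists by the intermediate value theorem. Since
  \<open>g\<close> is positive its antiderivative is invertible, and the inverse function theorem
  yields the derivative even where \<open>f\<close> vanishes.\<close>

lemma monotone_transport_map:
  fixes f g :: "real \<Rightarrow> real"
  assumes g: "continuous_on {0<..} g" "\<And>x. x > 0 \<Longrightarrow> g x > 0"
    and f: "continuous_on {0<..} f" "\<And>x. x > 0 \<Longrightarrow> f x \<ge> 0"
      "set_integrable lborel {0<..} f" "(LINT x:{0<..}|lborel. f x) = 1"
    and cd: "0 < c" "c < d"
  obtains U where "\<And>x. x > 0 \<Longrightarrow> U x \<in> {c..d}"
    "\<And>x. x > 0 \<Longrightarrow> (U has_real_derivative (LINT y:{c..d}|lborel. g y) * f x / g (U x)) (at x)"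
proof -
  define Z where "Z = (LINT y:{c..d}|lborel. g y)"
  obtain Phi where Phi: "\<And>x. x > 0 \<Longrightarrow> (Phi has_real_derivative g x) (at x)"
    using antiderivative_on_pos[OF g(1)] by blast
  have Z: "Z = Phi d - Phi c"
    unfolding Z_def using cd by (intro set_integral_FTC Phi continuous_on_subset[OF g(1)]) auto
  have mono: "Phi x < Phi y" if "0 < x" "x < y" for x y
    by (rule DERIV_pos_imp_increasing[where f = Phi, OF \<open>x < y\<close>]) (use that g(2) in \<open>fastforce intro: Phi\<close>)
  have inj: "x = y" if "Phi x = Phi y" "0 < x" "0 < y" for x y
    using mono[of x y] mono[of y x] that by (cases x y rule: linorder_cases) auto
  obtain F1 where F1: "\<And>x. x > 0 \<Longrightarrow> (F1 has_real_derivative f x) (at x)"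
    using antiderivative_on_pos[OF f(1)] by blast
  \<comment> \<open>\<open>F\<close> is the distribution function, with values between 0 and 1. It
    differs from \<open>F1\<close> by a constant and inherits differentiability from it.\<close>
  define F where "F x = (LINT y:{0<..x}|lborel. f y)" for x
  have F_diff: "F y - F x = F1 y - F1 x" if "0 < x" "x \<le> y" for x y
  proof -
    have "F y = (LINT z:{0<..x} \<union> {x<..y}|lborel. f z)"
      unfolding F_def using that by (intro arg_cong2[where f = "set_lebesgue_integral lborel"]) auto
    also have "\<dots> = F x + (LINT z:{x<..y}|lborel. f z)"
      unfolding F_def using that by (intro set_integral_Un set_integrable_subset[OF f(3)]) auto
    also have "(LINT z:{x<..y}|lborel. f z) = (LINT z:{x..y}|lborel. f z)"
    proof (rule set_integral_cong_set)
      have "set_borel_measurable lborel {0<..} f"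
        using f(3) by (simp add: set_borel_measurable_def set_integrable_def)
      then show "set_borel_measurable lborel {x..y} f" "set_borel_measurable lborel {x<..y} f"
        by (rule set_borel_measurable_subset; use that in auto)+
      show "AE z in lborel. (z \<in> {x..y}) = (z \<in> {x<..y})"
        using AE_lborel_singleton[of x] by eventually_elim auto
    qed
    also have "\<dots> = F1 y - F1 x"
      using that by (intro set_integral_FTC F1 continuous_on_subset[OF f(1)]) auto
    finally show ?thesis by simp
  qed
  have F: "(F has_real_derivative f x) (at x)" if "x > 0" for x
  proof (rule has_field_derivative_transform_within_open[where S = "{x/2<..}"])
    show "((\<lambda>y. F1 y - F1 (x/2) + F (x/2)) has_real_derivative f x) (at x)"
      using that by (auto intro!: derivative_eq_intros F1)
  qed (use that F_diff[of "x/2"] in \<open>auto simp: algebra_simps less_imp_le\<close>)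
  have F01: "0 \<le> F x" "F x \<le> 1" for x
  proof -
    show "0 \<le> F x" unfolding F_def set_lebesgue_integral_def
      using f(2) by (intro Bochner_Integration.integral_nonneg) (auto simp: indicator_def)
    have "F x \<le> (LINT y:{0<..}|lborel. f y)" unfolding F_def
      using f(2) by (intro set_integral_mono_subset f(3)) auto
    then show "F x \<le> 1" using f(4) by simp
  qed
  have "Z > 0" using Z mono[of c d] cd by simp
  have "\<exists>u\<in>{c..d}. Phi u = Phi c + Z * F x" for x
  proof -
    have "\<exists>u\<ge>c. u \<le> d \<and> Phi u = Phi c + Z * F x"
    proof (rule IVT)
      have "0 \<le> Z * F x" "Z * F x \<le> Z"
        using \<open>Z > 0\<close> F01[of x] mult_left_le[of "F x" Z] by (auto simp: mult_nonneg_nonneg)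
      then show "Phi c \<le> Phi c + Z * F x" "Phi c + Z * F x \<le> Phi d"
        using Z by linarith+
      show "\<forall>x. c \<le> x \<and> x \<le> d \<longrightarrow> isCont Phi x"
        using cd by (intro allI impI DERIV_isCont[OF Phi]) auto
    qed (use cd in auto)
    then show ?thesis by auto
  qed
  then obtain U where U: "\<And>x. U x \<in> {c..d}" "\<And>x. Phi (U x) = Phi c + Z * F x" by metis
  have dU: "(U has_real_derivative Z * f x / g (U x)) (at x)" if x: "x > 0" for x
  proof -
    define u where "u = U x"
    have u: "u > 0" using U(1)[of x] cd by (auto simp: u_def)
    define Psi where "Psi = inv_into {0<..} Phi"
    have Psi: "Psi (Phi z) = z" if "z > 0" for z
      unfolding Psi_def using that by (intro inv_into_f_f) (auto simp: inj_on_def intro: inj)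
    have "(Psi has_real_derivative 1 / g u) (at (Phi u))"
      unfolding has_field_derivative_def
    proof (rule has_derivative_inverse_strong[where f = Phi and x = u and f' = "(*) (g u)" and S = "{0<..}"])
      show "continuous_on {0<..} Phi"
        using Phi by (intro continuous_at_imp_continuous_on ballI DERIV_isCont) auto
      show "(Phi has_derivative (*) (g u)) (at u)"
        using Phi[OF u] by (simp add: has_field_derivative_def)
    qed (use u Psi g(2)[OF u] in auto)
    then have "((\<lambda>x. Psi (Phi c + Z * F x)) has_real_derivative 1 / g u * (0 + Z * f x)) (at x)"
      unfolding u_def U(2)
      by (rule DERIV_chain2) (auto intro!: derivative_eq_intros F x)
    moreover have "Psi (Phi c + Z * F y) = U y" for y
      using U(1)[of y] cd Psi[of "U y"] by (simp add: U(2))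
    ultimately show ?thesis by (simp add: u_def)
  qed
  show ?thesis
    by (rule that[of U]) (use U(1) dU in \<open>simp_all add: Z_def\<close>)
qed

section \<open>Pointwise bounds for the entropy integrand\<close>

text \<open>The logarithm of the change of variables formula, with \<open>y\<close> for the value of
  the density at \<open>x\<close>. For the transport map, \<open>p\<close> is its derivative in the
  coordinate \<open>2 * sqrt x\<close> and \<open>q\<close> is the ratio of image to point in that
  coordinate.\<close>

lemma ln_density_ratio_transport:
  assumes "x > 0" "U > 0" "\<alpha> > 0" "lam > 0" "Z > 0" "y > 0"
  defines "p \<equiv> Z * y / gamma_dens \<alpha> lam U * sqrt x / sqrt U" and "q \<equiv> sqrt U / sqrt x"
  shows "ln (y / gamma_dens \<alpha> lam x) = ln p - ln Z + 2 * (\<alpha> - 1/2) * ln q - lam * x * (q\<^sup>2 - 1)"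
proof -
  define L where "L = ln (lam powr \<alpha> / Gamma \<alpha>)"
  have pos: "lam powr \<alpha> / Gamma \<alpha> > 0" using assms by (simp add: Gamma_real_pos)
  have ln3: "ln (A * u powr b * exp c) = ln A + b * ln u + c" if "A > 0" "u > 0" for A u b c :: real
    using that by (simp add: ln_mult ln_powr)
  have g: "ln (gamma_dens \<alpha> lam u) = L + (\<alpha> - 1) * ln u + - lam * u" if "u > 0" for u
    using ln3[OF pos that, of "\<alpha> - 1" "- lam * u"] by (simp only: gamma_dens_def L_def)
  have gp: "gamma_dens \<alpha> lam x > 0" "gamma_dens \<alpha> lam U > 0"
    using assms by (auto intro: gamma_dens_pos)
  have "ln p = ln Z + ln y - ln (gamma_dens \<alpha> lam U) + ln x / 2 - ln U / 2"
    using assms gp by (simp add: p_def ln_mult ln_div ln_sqrt)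
  moreover have "ln q = ln U / 2 - ln x / 2"
    using assms by (simp add: q_def ln_div ln_sqrt)
  moreover have "lam * x * (q\<^sup>2 - 1) = lam * U - lam * x"
    using assms by (simp add: q_def power_divide field_simps)
  ultimately show ?thesis
    using assms gp by (simp add: ln_div g) (simp add: algebra_simps)
qed

text \<open>A perfect square divided by \<open>lam\<close>. The last summand is what the quadratic
  part of the potential leaves over in its convexity inequality; it pays for the score term.\<close>

lemma quadratic_completion_le:
  fixes lam :: real
  assumes "lam > 0" "x > 0"
  shows "0 \<le> r\<^sup>2 * \<rho>\<^sup>2 / lam + r * (\<rho> * (2 * sqrt x * (q - 1))) + lam * x * (q - 1)\<^sup>2"
proof -
  define t where "t = sqrt x * (q - 1)"
  have t: "x * (q - 1)\<^sup>2 = t\<^sup>2" using assms by (simp add: t_def power_mult_distrib)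
  have "r\<^sup>2 * \<rho>\<^sup>2 / lam + r * (\<rho> * (2 * t)) + lam * t\<^sup>2 = (r * \<rho> + lam * t)\<^sup>2 / lam"
    using assms by (simp add: power2_eq_square field_simps)
  also have "\<dots> \<ge> 0" using assms by simp
  finally show ?thesis using t by (simp add: t_def mult.assoc)
qed

text \<open>The two brackets are, up to the factor \<open>f\<close>, the integrands of the
  integration by parts and of the Stein identity. Together they give \<open>p - 1\<close> the
  coefficient \<open>P = r + (1 - r) * \<tau>\<close>, and maximising over \<open>p\<close> leaves
  the quadratic cost of the kernel. The term \<open>\<kappa> * ln q\<close> is bounded by its
  tangent at 1.\<close>

lemma transport_integrand_le_nonneg_kernel:
  fixes lam :: real
  assumes "lam > 0" "x > 0" "\<kappa> \<ge> 0" "0 < r" "r \<le> 1" "p > 0" "q > 0" "\<tau> \<ge> 0"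
  defines "v \<equiv> 2 * (lam * x - \<kappa>) * (q - 1)"
  shows "ln p - z + 2 * \<kappa> * ln q - lam * x * (q\<^sup>2 - 1) \<le>
    r * (\<rho> * (2 * sqrt x * (q - 1)) + (p - 1) - v) + (1 - r) * (\<tau> * (p - 1) - v) +
    (r\<^sup>2 * \<rho>\<^sup>2 / lam + (r - 1 - ln r) * (\<tau> - 1)\<^sup>2 - z)"
proof -
  define P where "P = 1 + (1 - r) * (\<tau> - 1)"
  have "P = r + (1 - r) * \<tau>" by (simp add: P_def algebra_simps)
  then have "P > 0" using assms by (simp add: add_pos_nonneg)
  have "ln p - P * (p - 1) \<le> (r - 1 - ln r) * (\<tau> - 1)\<^sup>2"
    using ln_minus_linear_le[OF \<open>p > 0\<close> \<open>P > 0\<close>] minus_ln_le_square[of r "\<tau> - 1"] assms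
    by (simp add: P_def)
  moreover have "\<kappa> * ln q \<le> \<kappa> * (q - 1)"
    using assms ln_le_minus_one[of q] by (intro mult_left_mono) auto
  moreover note quadratic_completion_le[OF assms(1,2), of r \<rho> q]
  moreover have "P * (p - 1) = r * (p - 1) + (1 - r) * (\<tau> * (p - 1))"
    by (simp add: P_def algebra_simps)
  moreover have "v + lam * x * (q - 1)\<^sup>2 = lam * x * (q\<^sup>2 - 1) - 2 * (\<kappa> * (q - 1))"
    by (simp add: v_def power2_eq_square algebra_simps)
  moreover have "r * (\<rho> * (2 * sqrt x * (q - 1)) + (p - 1) - v) + (1 - r) * (\<tau> * (p - 1) - v)
     = r * (\<rho> * (2 * sqrt x * (q - 1))) + r * (p - 1) + (1 - r) * (\<tau> * (p - 1)) - v"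
    by (simp add: algebra_simps)
  ultimately show ?thesis by linarith
qed

text \<open>Only the part with weight \<open>r\<close> is integrated by parts. The share
  \<open>1 - r\<close> of \<open>v\<close> is instead combined with
  \<open>2 * \<kappa> * ln q\<close>; maximising over \<open>q\<close> produces
  \<open>2 * (\<kappa> - lam * x)\<close>, and maximising over \<open>p\<close> produces the summand
  1.\<close>

lemma transport_integrand_le_left:
  fixes lam :: real
  assumes "lam > 0" "x > 0" "lam * x \<le> \<kappa>" "0 < r" "r \<le> 1" "p > 0" "q > 0"
  defines "v \<equiv> 2 * (lam * x - \<kappa>) * (q - 1)"
  shows "ln p - z + 2 * \<kappa> * ln q - lam * x * (q\<^sup>2 - 1) \<le>
    r * (\<rho> * (2 * sqrt x * (q - 1)) + (p - 1) - v) +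
    (r\<^sup>2 * \<rho>\<^sup>2 / lam + (r - 1 - ln r) * (1 + 2 * (\<kappa> - lam * x)) - z)"
proof -
  have k: "\<kappa> > 0" using assms mult_pos_pos[of lam x] by linarith
  define m where "m = lam * x / \<kappa>"
  have m: "0 \<le> m" "m \<le> 1" "\<kappa> * m = lam * x" using assms k by (simp_all add: m_def)
  define P where "P = r + (1 - r) * m"
  have "P > 0" using assms m by (simp add: P_def add_pos_nonneg)
  have "ln q - P * (q - 1) \<le> (r - 1 - ln r) * (1 - m)"
    using ln_minus_linear_le[OF \<open>q > 0\<close> \<open>P > 0\<close>] convex_combination_minus_ln_le[of r m] assms m
    by (simp add: P_def)
  then have "2 * \<kappa> * (ln q - P * (q - 1)) \<le> 2 * \<kappa> * ((r - 1 - ln r) * (1 - m))"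
    using k by (intro mult_left_mono) auto
  also have "\<dots> = (r - 1 - ln r) * (2 * (\<kappa> - \<kappa> * m))" by (simp add: algebra_simps)
  also have "2 * \<kappa> * (ln q - P * (q - 1)) = 2 * \<kappa> * ln q - 2 * r * \<kappa> * (q - 1) - 2 * (1 - r) * (\<kappa> * m) * (q - 1)"
    by (simp add: P_def algebra_simps)
  finally have "2 * \<kappa> * ln q - 2 * r * \<kappa> * (q - 1) - 2 * (1 - r) * (lam * x) * (q - 1)
      \<le> (r - 1 - ln r) * (2 * (\<kappa> - lam * x))" by (simp add: m)
  moreover have "ln p - r * (p - 1) \<le> r - 1 - ln r"
    using ln_minus_linear_le[of p r] assms by simp
  moreover note quadratic_completion_le[OF assms(1,2), of r \<rho> q]
  moreover have "2 * r * \<kappa> * (q - 1) + 2 * (1 - r) * (lam * x) * (q - 1) - lam * x * (q\<^sup>2 - 1)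
     = - (r * v) - lam * x * (q - 1)\<^sup>2"
    by (simp add: v_def power2_eq_square algebra_simps)
  ultimately show ?thesis by (simp add: algebra_simps)
qed

section \<open>Integration along the transport map\<close>

text \<open>The lower bound \<open>L\<close> serves only integrability: together with the upper
  bound it dominates the absolute value of \<open>N\<close>.\<close>

lemma set_integral_le_FTC:
  fixes N W W' K L :: "real \<Rightarrow> real"
  assumes "a \<le> b" and N: "set_borel_measurable lborel {a..b} N"
    and W: "\<And>x. x \<in> {a..b} \<Longrightarrow> (W has_real_derivative W' x) (at x)" "continuous_on {a..b} W'"
    and K: "set_integrable lborel {a..b} K" and L: "set_integrable lborel {a..b} L"
    and ae: "AE x in lborel. x \<in> {a..b} \<longrightarrow> L x \<le> N x \<and> N x \<le> W' x + K x"
  shows "set_integrable lborel {a..b} N"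
    and "(LINT x:{a..b}|lborel. N x) \<le> W b - W a + (LINT x:{a..b}|lborel. K x)"
proof -
  have W': "set_integrable lborel {a..b} W'"
    by (rule borel_integrable_atLeastAtMost'[OF W(2)])
  show N_int: "set_integrable lborel {a..b} N"
  proof (rule set_integrable_bound[OF _ N])
    show "set_integrable lborel {a..b} (\<lambda>x. \<bar>L x\<bar> + (\<bar>W' x\<bar> + \<bar>K x\<bar>))"
      by (intro set_integral_add set_integrable_abs W' K L)
    show "AE x in lborel. x \<in> {a..b} \<longrightarrow> norm (N x) \<le> norm (\<bar>L x\<bar> + (\<bar>W' x\<bar> + \<bar>K x\<bar>))"
      using ae by eventually_elim auto
  qed
  have "(LINT x:{a..b}|lborel. N x) \<le> (LINT x:{a..b}|lborel. W' x + K x)"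
    using ae by (intro set_integral_mono_AE N_int set_integral_add W' K) auto
  also have "\<dots> = W b - W a + (LINT x:{a..b}|lborel. K x)"
    using set_integral_FTC[OF \<open>a \<le> b\<close> _ W(2), of W] W(1) by (simp add: set_integral_add W' K)
  finally show "(LINT x:{a..b}|lborel. N x) \<le> W b - W a + (LINT x:{a..b}|lborel. K x)" .
qed

lemma set_integral_Icc_split:
  fixes f :: "real \<Rightarrow> real"
  assumes "a \<le> b" "b \<le> c" "set_integrable lborel {a..b} f" "set_integrable lborel {b..c} f"
  shows "set_integrable lborel {a..c} f"
    and "(LINT x:{a..c}|lborel. f x) = (LINT x:{a..b}|lborel. f x) + (LINT x:{b..c}|lborel. f x)"
proof -
  have eq: "{a..c} = {a..b} \<union> {b..c}" using assms by auto
  show "set_integrable lborel {a..c} f"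
    unfolding eq using assms by (intro set_integrable_Un) auto
  have "AE x in lborel. \<not> (x \<in> {a..b} \<and> x \<in> {b..c})"
    using AE_lborel_singleton[of b] by eventually_elim auto
  then show "(LINT x:{a..c}|lborel. f x) = (LINT x:{a..b}|lborel. f x) + (LINT x:{b..c}|lborel. f x)"
    unfolding eq using assms by (intro set_integral_Un_AE) auto
qed

section \<open>A density with a Stein kernel, and the sign of the kernel\<close>

lemma set_integrable_kernel_times_density:
  fixes f \<tau> :: "real \<Rightarrow> real"
  assumes [measurable]: "f \<in> borel_measurable borel" "\<tau> \<in> borel_measurable borel"
    and f_nonneg: "\<And>u. u > 0 \<Longrightarrow> f u \<ge> 0"
    and f_int: "set_integrable lborel {0<..} f"
    and tau_int: "set_integrable lborel {0<..} (\<lambda>u. f u * (\<tau> u - 1)\<^sup>2)"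
  shows "set_integrable lborel {0<..} (\<lambda>u. \<tau> u * f u)"
proof (rule set_integrable_bound)
  show "set_integrable lborel {0<..} (\<lambda>u. 2 * f u + f u * (\<tau> u - 1)\<^sup>2)"
    by (intro set_integral_add set_integrable_mult_right f_int tau_int)
  show "set_borel_measurable lborel {0<..} (\<lambda>u. \<tau> u * f u)"
    unfolding set_borel_measurable_def by measurable
  \<comment> \<open>Follows from \<open>\<bar>t\<bar> \<le> 1 + \<bar>t - 1\<bar>\<close> and the
    inequality of arithmetic and geometric means.\<close>
  have *: "\<bar>t\<bar> \<le> 2 + (t - 1)\<^sup>2" for t :: real
  proof -
    have "0 \<le> (\<bar>t - 1\<bar> - 1)\<^sup>2" by simp
    then have "2 * \<bar>t - 1\<bar> \<le> 1 + (t - 1)\<^sup>2" by (simp add: power2_diff)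
    then show ?thesis by (simp add: abs_if split: if_splits)
  qed
  show "AE u in lborel. u \<in> {0<..} \<longrightarrow> norm (\<tau> u * f u) \<le> norm (2 * f u + f u * (\<tau> u - 1)\<^sup>2)"
  proof (intro AE_I2 impI)
    fix u :: real assume "u \<in> {0<..}"
    then have "f u \<ge> 0" using f_nonneg by simp
    then have "\<bar>\<tau> u\<bar> * f u \<le> (2 + (\<tau> u - 1)\<^sup>2) * f u"
      by (intro mult_right_mono *)
    with \<open>f u \<ge> 0\<close> show "norm (\<tau> u * f u) \<le> norm (2 * f u + f u * (\<tau> u - 1)\<^sup>2)"
      by (simp add: abs_mult algebra_simps)
  qed
qed

text \<open>\<open>G\<close> is the continuous version of \<open>\<tau> * sqrt u * f\<close>; it is differentiable although the Stein
  kernel itself is only measurable.\<close>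

locale gamma_stein =
  fixes \<alpha> lam :: real and f \<tau> h' G :: "real \<Rightarrow> real"
  assumes alpha: "\<alpha> \<ge> 1/2" and lam: "lam > 0"
    and f_meas [measurable]: "f \<in> borel_measurable borel"
    and f_nonneg: "u > 0 \<Longrightarrow> f u \<ge> 0"
    and f_int: "set_integrable lborel {0<..} f" and f_one: "(LINT u:{0<..}|lborel. f u) = 1"
    and h_deriv: "u > 0 \<Longrightarrow> ((\<lambda>u. f u / gamma_dens \<alpha> lam u) has_real_derivative h' u) (at u)"
    and h'_cont: "continuous_on {0<..} h'"
    and fisher_int: "set_integrable lborel {0<..} (\<lambda>u. f u * stein_fisher_integrand f \<alpha> lam u)"
    and tau_meas [measurable]: "\<tau> \<in> borel_measurable borel"
    and tau_int: "set_integrable lborel {0<..} (\<lambda>u. f u * (\<tau> u - 1)\<^sup>2)"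
    and G_deriv: "u > 0 \<Longrightarrow> (G has_real_derivative (\<alpha> - 1/2 - lam * u) / sqrt u * f u) (at u)"
    and G_AE: "AE u in lborel. u > 0 \<longrightarrow> \<tau> u * sqrt u * f u = G u"
begin

abbreviation "\<gamma> \<equiv> gamma_dens \<alpha> lam"

definition "\<kappa> = \<alpha> - 1/2"
definition "N u = f u * ln (f u / \<gamma> u)"

lemma kappa_nonneg: "\<kappa> \<ge> 0" using alpha by (simp add: \<kappa>_def)
lemma alpha_pos: "\<alpha> > 0" using alpha by simp

lemma dens_pos: "u > 0 \<Longrightarrow> \<gamma> u > 0"
  using gamma_dens_pos alpha_pos lam by blast

lemma dens_cont: "S \<subseteq> {0<..} \<Longrightarrow> continuous_on S \<gamma>"
  by (intro continuous_at_imp_continuous_on ballI DERIV_isCont[OF gamma_dens_has_derivative]) auto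

lemma f_deriv:
  assumes "u > 0"
  shows "(f has_real_derivative h' u * \<gamma> u + f u * ((\<alpha> - 1) / u - lam)) (at u)"
proof -
  have "((\<lambda>u. f u / \<gamma> u * \<gamma> u) has_real_derivative
      h' u * \<gamma> u + \<gamma> u * ((\<alpha> - 1) / u - lam) * (f u / \<gamma> u)) (at u)"
    by (intro DERIV_mult h_deriv gamma_dens_has_derivative assms)
  then have "(f has_real_derivative h' u * \<gamma> u + \<gamma> u * ((\<alpha> - 1) / u - lam) * (f u / \<gamma> u)) (at u)"
    by (rule has_field_derivative_transform_within_open[where S = "{0<..}"])
      (use assms dens_pos in force)+
  then show ?thesis using dens_pos[OF assms] by (simp add: mult.commute)
qed

lemma f_cont: "S \<subseteq> {0<..} \<Longrightarrow> continuous_on S f"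
  by (intro continuous_at_imp_continuous_on ballI DERIV_isCont[OF f_deriv]) auto

lemma G_cont: "S \<subseteq> {0<..} \<Longrightarrow> continuous_on S G"
  by (intro continuous_at_imp_continuous_on ballI DERIV_isCont[OF G_deriv]) auto

text \<open>The density may vanish, and then the score is undefined. A zero is a minimum of the
  nonnegative ratio \<open>f / \<gamma>\<close>, so the derivative that carries the score vanishes
  there too.\<close>

lemma h'_eq_0:
  assumes "u > 0" "f u = 0"
  shows "h' u = 0"
proof (rule DERIV_local_min[OF h_deriv[OF assms(1)] assms(1)])
  show "\<forall>y. \<bar>u - y\<bar> < u \<longrightarrow> f u / \<gamma> u \<le> f y / \<gamma> y"
    using assms f_nonneg dens_pos by (auto simp: abs_if split: if_splits intro!: divide_nonneg_pos)
qed

text \<open>\<open>h' * \<gamma> / f\<close> is the logarithmic derivative of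
  \<open>f / \<gamma>\<close>; the factor \<open>sqrt u\<close> converts it to the coordinate
  \<open>2 * sqrt u\<close>.\<close>

lemma fisher_eq:
  assumes "u > 0" "f u > 0"
  shows "stein_fisher_integrand f \<alpha> lam u = (sqrt u * (h' u * \<gamma> u / f u))\<^sup>2"
  using assms DERIV_imp_deriv[OF f_deriv[OF assms(1)]]
  by (simp add: stein_fisher_integrand_def power_mult_distrib power_divide add_divide_distrib)

lemma fisher_nonneg: "u > 0 \<Longrightarrow> f u * stein_fisher_integrand f \<alpha> lam u \<ge> 0"
  using f_nonneg by (simp add: stein_fisher_integrand_def)

lemma tau_f_int: "set_integrable lborel {0<..} (\<lambda>u. \<tau> u * f u)"
  by (rule set_integrable_kernel_times_density[OF f_meas tau_meas f_nonneg f_int tau_int])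

lemma G_mono_left:
  assumes "0 < x" "x \<le> y" "lam * y \<le> \<kappa>"
  shows "G x \<le> G y"
proof (rule DERIV_nonneg_imp_nondecreasing[where f = G, OF assms(2)])
  fix u assume u: "x \<le> u" "u \<le> y"
  have "lam * u \<le> lam * y" using u lam by simp
  then have "0 \<le> (\<alpha> - 1/2 - lam * u) / sqrt u * f u"
    using u assms f_nonneg[of u] by (intro mult_nonneg_nonneg divide_nonneg_nonneg) (auto simp: \<kappa>_def)
  then show "\<exists>D. (G has_real_derivative D) (at u) \<and> 0 \<le> D"
    using G_deriv[of u] u assms(1) by fastforce
qed

lemma G_mono_right:
  assumes "0 < x" "x \<le> y" "\<kappa> \<le> lam * x"
  shows "G y \<le> G x"
proof (rule DERIV_nonpos_imp_nonincreasing[where f = G, OF assms(2)])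
  fix u assume u: "x \<le> u" "u \<le> y"
  have "lam * x \<le> lam * u" using u lam by simp
  then have "(\<alpha> - 1/2 - lam * u) / sqrt u * f u \<le> 0"
    using u assms f_nonneg[of u] by (intro mult_nonpos_nonneg divide_nonpos_nonneg) (auto simp: \<kappa>_def)
  then show "\<exists>D. (G has_real_derivative D) (at u) \<and> D \<le> 0"
    using G_deriv[of u] u assms(1) by fastforce
qed

lemma inverse_sqrt_integral:
  assumes "0 < a" "a \<le> b"
  shows "set_integrable lborel {a..b} (\<lambda>x. k / sqrt x)"
    and "(LINT x:{a..b}|lborel. k / sqrt x) = 2 * k * (sqrt b - sqrt a)"
proof -
  have cont: "continuous_on {a..b} (\<lambda>x. k / sqrt x)"
    using assms by (intro continuous_intros) auto
  show "set_integrable lborel {a..b} (\<lambda>x. k / sqrt x)"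
    by (rule borel_integrable_atLeastAtMost'[OF cont])
  have "(LINT x:{a..b}|lborel. k / sqrt x) = 2 * k * sqrt b - 2 * k * sqrt a"
    using assms by (intro set_integral_FTC cont) (auto intro!: derivative_eq_intros simp: field_simps)
  then show "(LINT x:{a..b}|lborel. k / sqrt x) = 2 * k * (sqrt b - sqrt a)"
    by (simp add: algebra_simps)
qed

text \<open>\<open>G\<close> is nonincreasing from \<open>x\<close> on. A negative value would keep
  \<open>\<tau> * f\<close> below a negative multiple of \<open>1 / sqrt u\<close>, which
  contradicts its integrability at infinity.\<close>

lemma G_nonneg_right:
  assumes "0 < x" "\<kappa> \<le> lam * x"
  shows "G x \<ge> 0"
proof (rule ccontr)
  assume "\<not> G x \<ge> 0"
  define k where "k = - G x"
  have k: "k > 0" using \<open>\<not> G x \<ge> 0\<close> by (simp add: k_def)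
  define M where "M = (LINT u:{0<..}|lborel. \<bar>\<tau> u * f u\<bar>)"
  \<comment> \<open>Makes the integral of \<open>k / sqrt u\<close> from \<open>x\<close> to
    \<open>y\<close> equal to \<open>\<bar>M\<bar> + 1\<close>, more than the available mass
    \<open>M\<close>.\<close>
  define y where "y = (sqrt x + (\<bar>M\<bar> + 1) / (2 * k))\<^sup>2"
  have sy: "sqrt y = sqrt x + (\<bar>M\<bar> + 1) / (2 * k)"
    using k assms by (simp add: y_def add_nonneg_nonneg)
  have "sqrt x \<le> sqrt y" using k by (simp add: sy)
  then have "x \<le> y" by simp
  have "2 * k * (sqrt y - sqrt x) = (LINT u:{x..y}|lborel. k / sqrt u)"
    using inverse_sqrt_integral(2)[of x y k] assms \<open>x \<le> y\<close> by simp
  also have "\<dots> \<le> (LINT u:{x..y}|lborel. \<bar>\<tau> u * f u\<bar>)"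
  proof (rule set_integral_mono_AE)
    show "AE u\<in>{x..y} in lborel. k / sqrt u \<le> \<bar>\<tau> u * f u\<bar>"
      using G_AE
    proof (eventually_elim, intro impI)
      fix u assume *: "u > 0 \<longrightarrow> \<tau> u * sqrt u * f u = G u" "u \<in> {x..y}"
      then have "u > 0" using assms by auto
      then have "\<tau> u * f u = G u / sqrt u" using * by (auto simp: field_simps)
      moreover have "k / sqrt u \<le> - G u / sqrt u"
        using G_mono_right[of x u] assms * \<open>u > 0\<close> by (intro divide_right_mono) (auto simp: k_def)
      ultimately have "k / sqrt u \<le> - (\<tau> u * f u)" by simp
      then show "k / sqrt u \<le> \<bar>\<tau> u * f u\<bar>" by linarith
    qed
    show "set_integrable lborel {x..y} (\<lambda>u. \<bar>\<tau> u * f u\<bar>)"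
      by (rule set_integrable_subset[OF set_integrable_abs[OF tau_f_int]]) (use assms in auto)
  qed (use inverse_sqrt_integral(1)[of x y k] assms \<open>x \<le> y\<close> in auto)
  also have "\<dots> \<le> M"
    unfolding M_def by (rule set_integral_mono_subset[OF set_integrable_abs[OF tau_f_int]]) (use assms in auto)
  finally show False using k by (simp add: sy)
qed

text \<open>\<open>G\<close> is nondecreasing up to \<open>\<kappa> / lam\<close> and nonnegative
  afterwards, so it can be negative only on an initial interval. At the end of that interval it
  vanishes, which later joins the two integration schemes without a boundary term.\<close>

lemma G_sign_change:
  obtains "\<And>x. x > 0 \<Longrightarrow> G x \<ge> 0"
  | x0 where "x0 > 0" "lam * x0 \<le> \<kappa>" "G x0 = 0" "\<And>x. 0 < x \<Longrightarrow> x \<le> x0 \<Longrightarrow> G x \<le> 0" "\<And>x. x0 \<le> x \<Longrightarrow> G x \<ge> 0"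
proof (cases "\<forall>x>0. G x \<ge> 0")
  case False
  then obtain x1 where x1: "x1 > 0" "G x1 < 0" by force
  define x2 where "x2 = \<kappa> / lam"
  have x2: "lam * x2 = \<kappa>" using lam by (simp add: x2_def)
  have "lam * x1 < lam * x2" using G_nonneg_right[OF x1(1)] x1 x2 by linarith
  then have "x1 < x2" using lam by simp
  have "\<exists>x\<ge>x1. x \<le> x2 \<and> G x = 0"
  proof (rule IVT)
    show "0 \<le> G x2" using G_nonneg_right[of x2] x1 \<open>x1 < x2\<close> x2 by simp
    show "\<forall>x. x1 \<le> x \<and> x \<le> x2 \<longrightarrow> isCont G x"
      using x1 by (intro allI impI DERIV_isCont[OF G_deriv]) auto
  qed (use x1 \<open>x1 < x2\<close> in auto)
  then obtain x0 where x0: "x1 \<le> x0" "x0 \<le> x2" "G x0 = 0" by blast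
  have lx0: "lam * x0 \<le> \<kappa>" using x0 lam by (simp add: x2[symmetric])
  have "G x \<ge> 0" if "x0 \<le> x" for x
  proof (cases "lam * x \<le> \<kappa>")
    case True
    then show ?thesis using G_mono_left[of x0 x] x0 x1 that by simp
  next
    case False
    then show ?thesis using G_nonneg_right[of x] x0 x1 that by simp
  qed
  moreover have "G x \<le> 0" if "0 < x" "x \<le> x0" for x
    using G_mono_left[of x x0] that lx0 x0 by simp
  ultimately show ?thesis using that(2)[of x0] x0 x1 lx0 by simp
qed (use that(1) in blast)

text \<open>Where the kernel is negative it is replaced by the pair (radial part \<open>0\<close>, angular part
  \<open>lam * x / \<kappa>\<close>), thinking of \<open>X\<close> as the squared radius of a Gaussian vector in dimension
  \<open>2 * \<alpha>\<close>. The squared deviation of this pair from \<open>(1, 1)\<close> is at most the integrand on the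
  left, and this lemma shows that the replacement does not increase the discrepancy.\<close>

lemma left_kernel_cost:
  assumes x0: "lam * x0 \<le> \<kappa>" "G x0 = 0" "\<And>x. 0 < x \<Longrightarrow> x \<le> x0 \<Longrightarrow> G x \<le> 0" and a: "0 < a" "a \<le> x0"
  shows "(LINT x:{a..x0}|lborel. f x * (1 + 2 * (\<kappa> - lam * x))) \<le> (LINT x:{a/4..x0}|lborel. f x * (\<tau> x - 1)\<^sup>2)"
proof -
  \<comment> \<open>Almost everywhere this is \<open>f * (1 - 2 * \<tau>)\<close>, the target
    integrand without \<open>f * \<tau>\<^sup>2\<close>; unlike the target it is continuous.\<close>
  define Q where "Q x = f x - 2 * G x / sqrt x" for x
  have Gs: "set_integrable lborel {s..t} (\<lambda>x. k * G x / sqrt x)" if "0 < s" for s t k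
    using that by (intro borel_integrable_atLeastAtMost' continuous_intros G_cont) auto
  have fs: "set_integrable lborel {s..t} f" if "0 < s" for s t
    using that by (intro borel_integrable_atLeastAtMost' f_cont) auto
  have Q_int: "set_integrable lborel {s..t} Q" if "0 < s" for s t
    unfolding Q_def[abs_def] using that by (intro set_integral_diff fs Gs)
  have fk: "set_integrable lborel {a..x0} (\<lambda>x. 2 * (\<kappa> - lam * x) * f x)"
    using a by (intro borel_integrable_atLeastAtMost' continuous_intros f_cont) auto
  \<comment> \<open>The integrand is the derivative of \<open>2 * sqrt x * G x\<close>, which
    vanishes at \<open>x0\<close>. This trades the weight \<open>2 * (\<kappa> - lam * x)\<close>
    for \<open>G\<close> and a boundary term at \<open>a\<close>.\<close>
  have "(LINT x:{a..x0}|lborel. 1 * G x / sqrt x + 2 * (\<kappa> - lam * x) * f x) = 2 * sqrt x0 * G x0 - 2 * sqrt a * G a"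
  proof (rule set_integral_FTC)
    fix x assume "a \<le> x" "x \<le> x0"
    then have "x > 0" using a by simp
    then show "((\<lambda>x. 2 * sqrt x * G x) has_real_derivative 1 * G x / sqrt x + 2 * (\<kappa> - lam * x) * f x) (at x)"
      by (auto intro!: derivative_eq_intros G_deriv simp: \<kappa>_def field_simps)
  qed (use a in \<open>auto intro!: continuous_intros G_cont f_cont\<close>)
  then have 1: "(LINT x:{a..x0}|lborel. 2 * (\<kappa> - lam * x) * f x) = - (2 * sqrt a * G a) - (LINT x:{a..x0}|lborel. 1 * G x / sqrt x)"
    using x0(2) fk Gs[OF a(1), of x0 1] by (simp add: set_integral_add)
  \<comment> \<open>The boundary term is spread over \<open>{a/4..a}\<close>: the quarter is chosen
    because \<open>1 / sqrt x\<close> has integral exactly \<open>sqrt a\<close> there. Monotonicity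
    of \<open>G\<close> then allows \<open>G a\<close> to be replaced by \<open>G x\<close>.\<close>
  have "sqrt (a / 4) = sqrt a / 2" by (simp add: real_sqrt_divide)
  then have "- (2 * sqrt a * G a) = (LINT x:{a/4..a}|lborel. (- 2 * G a) / sqrt x)"
    using a by (subst inverse_sqrt_integral) (auto simp: algebra_simps)
  also have "\<dots> \<le> (LINT x:{a/4..a}|lborel. Q x)"
  proof (rule set_integral_mono)
    fix x assume x: "x \<in> {a/4..a}"
    then have "x > 0" using a by auto
    have "lam * a \<le> \<kappa>" using a x0(1) lam mult_left_mono[of a x0 lam] by linarith
    then have "- 2 * G a / sqrt x \<le> - 2 * G x / sqrt x"
      using G_mono_left[of x a] x \<open>x > 0\<close> by (intro divide_right_mono) auto
    also have "\<dots> \<le> Q x" using f_nonneg[OF \<open>x > 0\<close>] by (simp add: Q_def)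
    finally show "- 2 * G a / sqrt x \<le> Q x" .
  qed (use a inverse_sqrt_integral(1)[of "a/4" a "- 2 * G a"] Q_int in auto)
  finally have 2: "- (2 * sqrt a * G a) \<le> (LINT x:{a/4..a}|lborel. Q x)" .
  have "(LINT x:{a..x0}|lborel. f x) - (LINT x:{a..x0}|lborel. 1 * G x / sqrt x) = (LINT x:{a..x0}|lborel. f x - 1 * G x / sqrt x)"
    by (rule set_integral_diff(2)[symmetric]) (intro fs Gs a)+
  also have "\<dots> \<le> (LINT x:{a..x0}|lborel. Q x)"
  proof (rule set_integral_mono)
    fix x assume "x \<in> {a..x0}"
    then have "x > 0" "G x \<le> 0" using x0(3) a by auto
    then have "G x / sqrt x \<le> 0" by (simp add: divide_nonpos_nonneg)
    then show "f x - 1 * G x / sqrt x \<le> Q x" by (simp add: Q_def)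
  qed (intro Q_int set_integral_diff fs Gs a)+
  finally have 3: "(LINT x:{a..x0}|lborel. f x) - (LINT x:{a..x0}|lborel. 1 * G x / sqrt x) \<le> (LINT x:{a..x0}|lborel. Q x)" .
  have "(LINT x:{a..x0}|lborel. f x * (1 + 2 * (\<kappa> - lam * x))) = (LINT x:{a..x0}|lborel. f x + 2 * (\<kappa> - lam * x) * f x)"
    by (intro set_lebesgue_integral_cong) (auto simp: algebra_simps)
  also have "\<dots> = (LINT x:{a..x0}|lborel. f x) + (LINT x:{a..x0}|lborel. 2 * (\<kappa> - lam * x) * f x)"
    by (rule set_integral_add(2)) (intro fs fk a)+
  also have "\<dots> \<le> (LINT x:{a/4..a}|lborel. Q x) + (LINT x:{a..x0}|lborel. Q x)"
    using 1 2 3 by linarith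
  also have "\<dots> = (LINT x:{a/4..x0}|lborel. Q x)"
    using a by (intro set_integral_Icc_split(2)[symmetric] Q_int) auto
  also have "\<dots> \<le> (LINT x:{a/4..x0}|lborel. f x * (\<tau> x - 1)\<^sup>2)"
  proof (rule set_integral_mono_AE)
    show "AE x\<in>{a/4..x0} in lborel. Q x \<le> f x * (\<tau> x - 1)\<^sup>2"
      using G_AE
    proof (eventually_elim, intro impI)
      fix x assume *: "x > 0 \<longrightarrow> \<tau> x * sqrt x * f x = G x" "x \<in> {a/4..x0}"
      then have "x > 0" using a by auto
      then have "\<tau> x * f x = G x / sqrt x" using * by (auto simp: field_simps)
      then have "2 * G x / sqrt x = 2 * (\<tau> x * f x)" by simp
      then have "f x * (\<tau> x - 1)\<^sup>2 = Q x + f x * (\<tau> x)\<^sup>2"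
        by (simp add: Q_def power2_eq_square algebra_simps)
      then show "Q x \<le> f x * (\<tau> x - 1)\<^sup>2" using f_nonneg[OF \<open>x > 0\<close>] by simp
    qed
    show "set_integrable lborel {a/4..x0} (\<lambda>x. f x * (\<tau> x - 1)\<^sup>2)"
      by (rule set_integrable_subset[OF tau_int]) (use a in auto)
  qed (use a Q_int in auto)
  finally show ?thesis .
qed

section \<open>Compact subintervals and a lower bound for the entropy integrand\<close>

lemma subinterval_int:
  assumes "0 < a"
  shows "set_integrable lborel {a..b} f"
    "set_integrable lborel {a..b} (\<lambda>x. f x * stein_fisher_integrand f \<alpha> lam x)"
    "set_integrable lborel {a..b} (\<lambda>x. f x * (\<tau> x - 1)\<^sup>2)"
    "set_integrable lborel {a..b} (\<lambda>x. f x * (1 + 2 * (\<kappa> - lam * x)))"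
    "set_integrable lborel {a..b} \<gamma>"
proof -
  have sub: "{a..b} \<subseteq> {0<..}" using assms by auto
  show "set_integrable lborel {a..b} f"
    "set_integrable lborel {a..b} (\<lambda>x. f x * stein_fisher_integrand f \<alpha> lam x)"
    "set_integrable lborel {a..b} (\<lambda>x. f x * (\<tau> x - 1)\<^sup>2)"
    by (intro set_integrable_subset[OF _ _ sub] f_int fisher_int tau_int; simp)+
  show "set_integrable lborel {a..b} (\<lambda>x. f x * (1 + 2 * (\<kappa> - lam * x)))"
    by (intro borel_integrable_atLeastAtMost' continuous_on_mult f_cont sub continuous_intros)
  show "set_integrable lborel {a..b} \<gamma>"
    by (intro borel_integrable_atLeastAtMost' dens_cont sub)
qed

lemma N_meas [measurable]: "N \<in> borel_measurable borel"
  unfolding N_def[abs_def] by measurable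

text \<open>From \<open>ln s \<le> s - 1\<close> at \<open>s = \<gamma> x / f x\<close>. It gives
  integrability from below, and it makes \<open>N - f + \<gamma>\<close> nonnegative for a monotone
  limit.\<close>

lemma N_ge: "x > 0 \<Longrightarrow> f x - \<gamma> x \<le> N x"
proof -
  assume x: "x > 0"
  show ?thesis
  proof (cases "f x = 0")
    case True
    then show ?thesis using dens_pos[OF x] by (simp add: N_def)
  next
    case False
    then have fx: "f x > 0" using f_nonneg[OF x] by simp
    have "ln (\<gamma> x / f x) \<le> \<gamma> x / f x - 1"
      using fx dens_pos[OF x] by (intro ln_le_minus_one) simp
    then have "1 - \<gamma> x / f x \<le> ln (f x / \<gamma> x)"
      using fx dens_pos[OF x] by (simp add: ln_div)
    then have "f x * (1 - \<gamma> x / f x) \<le> f x * ln (f x / \<gamma> x)"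
      using fx by (intro mult_left_mono) auto
    then show ?thesis using fx by (simp add: N_def right_diff_distrib)
  qed
qed

definition "J = (LINT x:{0<..}|lborel. f x * stein_fisher_integrand f \<alpha> lam x)"
definition "discr = (LINT x:{0<..}|lborel. f x * (\<tau> x - 1)\<^sup>2)"

lemma subinterval_bounds:
  assumes "0 < a"
  shows "(LINT x:{a..b}|lborel. f x * stein_fisher_integrand f \<alpha> lam x) \<le> J"
    "(LINT x:{a..b}|lborel. f x * (\<tau> x - 1)\<^sup>2) \<le> discr"
    "(LINT x:{a..b}|lborel. f x) \<le> 1"
proof -
  have sub: "{a..b} \<subseteq> {0<..}" using assms by auto
  show "(LINT x:{a..b}|lborel. f x * stein_fisher_integrand f \<alpha> lam x) \<le> J" unfolding J_def
    by (rule set_integral_mono_subset[OF fisher_int _ sub]) (auto intro: fisher_nonneg)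
  show "(LINT x:{a..b}|lborel. f x * (\<tau> x - 1)\<^sup>2) \<le> discr" unfolding discr_def
    by (rule set_integral_mono_subset[OF tau_int _ sub]) (auto intro!: mult_nonneg_nonneg f_nonneg)
  show "(LINT x:{a..b}|lborel. f x) \<le> 1" unfolding f_one[symmetric]
    by (rule set_integral_mono_subset[OF f_int _ sub]) (auto intro: f_nonneg)
qed

end

text \<open>\<open>U\<close> transports \<open>f\<close> to the gamma law conditioned on \<open>{c..d}\<close>, an event of probability \<open>Z\<close>.
  Conditioning keeps \<open>U\<close> away from \<open>0\<close> and infinity, so the displacement \<open>\<theta>\<close> in the coordinate
  \<open>2 * sqrt x\<close> is positive near \<open>0\<close> and negative near infinity, and all boundary terms of the
  integrations by parts have a favourable sign.\<close>

locale gamma_transport = gamma_stein +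
  fixes c d r Z :: real and U :: "real \<Rightarrow> real"
  assumes cd: "0 < c" "c < d" and r: "0 < r" "r \<le> 1" and Z: "0 < Z" "Z \<le> 1"
    and U_range: "x > 0 \<Longrightarrow> U x \<in> {c..d}"
    and U_deriv: "x > 0 \<Longrightarrow> (U has_real_derivative Z * f x / \<gamma> (U x)) (at x)"
begin

section \<open>Displacement and boundary terms of the transport\<close>

definition "\<theta> x = 2 * (sqrt (U x) - sqrt x)"
text \<open>The derivative is taken in \<open>x\<close>; multiplied by \<open>sqrt x\<close> it
  becomes the derivative in \<open>2 * sqrt x\<close>, that is \<open>p - 1\<close>.\<close>

definition "\<theta>' x = Z * f x / \<gamma> (U x) / sqrt (U x) - 1 / sqrt x"
definition "v x = (lam * x - \<kappa>) / sqrt x * \<theta> x"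
text \<open>\<open>WL\<close> is the primitive belonging to integration by parts against the
  density, and \<open>WR\<close> adds the primitive from the Stein identity. The letter
  \<open>L\<close> marks the initial interval where \<open>G\<close> may be negative,
  \<open>R\<close> the rest.\<close>

definition "WL x = r * (sqrt x * f x * \<theta> x)"
definition "WL' x = r * (sqrt x * (h' x * \<gamma> x) * \<theta> x + f x * (sqrt x * \<theta>' x) - f x * v x)"
definition "WR x = WL x + (1 - r) * (G x * \<theta> x)"
definition "WR' x = WL' x + (1 - r) * (G x * \<theta>' x - f x * v x)"
definition "cost = r - 1 - ln r"
text \<open>\<open>KL\<close> and \<open>KR\<close> collect what the pointwise bounds leave beside
  the total derivatives. They differ only in the density multiplied by \<open>cost\<close>.\<close>

definition "KL x = r\<^sup>2 / lam * (f x * stein_fisher_integrand f \<alpha> lam x) + cost * (f x * (1 + 2 * (\<kappa> - lam * x))) - ln Z * f x"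
definition "KR x = r\<^sup>2 / lam * (f x * stein_fisher_integrand f \<alpha> lam x) + cost * (f x * (\<tau> x - 1)\<^sup>2) - ln Z * f x"

lemma U_pos: "x > 0 \<Longrightarrow> U x > 0"
  using U_range[of x] cd by auto

lemma cost_nonneg: "cost \<ge> 0"
  using ln_le_minus_one[of r] r by (simp add: cost_def)

lemma U_cont: "S \<subseteq> {0<..} \<Longrightarrow> continuous_on S U"
  by (intro continuous_at_imp_continuous_on ballI DERIV_isCont[OF U_deriv]) auto

lemma \<theta>_deriv:
  assumes "x > 0"
  shows "(\<theta> has_real_derivative \<theta>' x) (at x)"
proof -
  have "((\<lambda>x. sqrt (U x)) has_real_derivative inverse (sqrt (U x)) / 2 * (Z * f x / \<gamma> (U x))) (at x)"
    by (rule DERIV_chain2[OF DERIV_real_sqrt[OF U_pos[OF assms]] U_deriv[OF assms]])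
  moreover have "(sqrt has_real_derivative inverse (sqrt x) / 2) (at x)"
    by (rule DERIV_real_sqrt[OF assms])
  ultimately have "(\<theta> has_real_derivative 2 * (inverse (sqrt (U x)) / 2 * (Z * f x / \<gamma> (U x)) - inverse (sqrt x) / 2)) (at x)"
    unfolding \<theta>_def[abs_def] by (intro DERIV_cmult DERIV_diff)
  then show ?thesis
    by (rule DERIV_cong) (simp add: \<theta>'_def inverse_eq_divide right_diff_distrib)
qed

lemma \<theta>_cont: "S \<subseteq> {0<..} \<Longrightarrow> continuous_on S \<theta>"
  by (intro continuous_at_imp_continuous_on ballI DERIV_isCont[OF \<theta>_deriv]) auto

lemma \<theta>'_cont:
  assumes S: "S \<subseteq> {0<..}"
  shows "continuous_on S \<theta>'"
proof -
  have "continuous_on S (\<lambda>x. \<gamma> (U x))"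
    by (rule continuous_on_compose2[OF dens_cont[of "{0<..}"] U_cont[OF S]]) (use S U_pos in auto)
  moreover have "\<gamma> (U x) \<noteq> 0" "sqrt (U x) \<noteq> 0" "sqrt x \<noteq> 0" if "x \<in> S" for x
    using dens_pos[of "U x"] U_pos[of x] that S by auto
  ultimately show ?thesis
    unfolding \<theta>'_def[abs_def]
    by (intro continuous_on_diff continuous_on_divide continuous_on_mult continuous_on_const
        continuous_on_real_sqrt continuous_on_id f_cont[OF S] U_cont[OF S]) blast+
qed

text \<open>The logarithmic derivative of \<open>sqrt x * \<gamma> x\<close> is
  \<open>- (lam * x - \<kappa>) / sqrt x\<close>. Differentiating \<open>sqrt x * f x\<close>
  therefore gives the score term and the drift that appears in \<open>v\<close>.\<close>

lemma WL_deriv: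
  assumes "x > 0"
  shows "(WL has_real_derivative WL' x) (at x)"
proof -
  have "((\<lambda>x. sqrt x * f x * \<theta> x) has_real_derivative
     (inverse (sqrt x) / 2 * f x + (h' x * \<gamma> x + f x * ((\<alpha> - 1) / x - lam)) * sqrt x) * \<theta> x + \<theta>' x * (sqrt x * f x)) (at x)"
    by (intro DERIV_mult DERIV_real_sqrt f_deriv \<theta>_deriv assms)
  moreover have "(inverse (sqrt x) / 2 * f x + (h' x * \<gamma> x + f x * ((\<alpha> - 1) / x - lam)) * sqrt x) * \<theta> x + \<theta>' x * (sqrt x * f x)
     = sqrt x * (h' x * \<gamma> x) * \<theta> x + f x * (sqrt x * \<theta>' x) - f x * v x"
  proof -
    have "inverse s / 2 + ((\<alpha> - 1) / (s * s) - lam) * s = - ((lam * (s * s) - \<kappa>) / s)" if "s > 0" for s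
      using that by (simp add: \<kappa>_def field_simps)
    from this[of "sqrt x"]
    have "inverse (sqrt x) / 2 + ((\<alpha> - 1) / x - lam) * sqrt x = - ((lam * x - \<kappa>) / sqrt x)"
      using assms by simp
    then have "(inverse (sqrt x) / 2 + ((\<alpha> - 1) / x - lam) * sqrt x) * (f x * \<theta> x) = - ((lam * x - \<kappa>) / sqrt x) * (f x * \<theta> x)"
      by simp
    then show ?thesis by (simp add: v_def algebra_simps)
  qed
  ultimately show ?thesis
    unfolding WL_def[abs_def] WL'_def by (intro DERIV_cmult) (simp only:)
qed

lemma WR_deriv:
  assumes "x > 0"
  shows "(WR has_real_derivative WR' x) (at x)"
proof -
  have "((\<lambda>x. G x * \<theta> x) has_real_derivative (\<alpha> - 1/2 - lam * x) / sqrt x * f x * \<theta> x + \<theta>' x * G x) (at x)"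
    by (intro DERIV_mult G_deriv \<theta>_deriv assms)
  moreover have "(\<alpha> - 1/2 - lam * x) / sqrt x * f x * \<theta> x + \<theta>' x * G x = G x * \<theta>' x - f x * v x"
    using assms by (simp add: v_def \<kappa>_def divide_simps) (simp add: algebra_simps)
  ultimately show ?thesis
    unfolding WR_def[abs_def] WR'_def by (intro DERIV_add DERIV_cmult WL_deriv assms) (simp only:)
qed

lemma WL'_cont: "S \<subseteq> {0<..} \<Longrightarrow> continuous_on S WL'"
  unfolding WL'_def[abs_def] v_def[abs_def]
  by (intro continuous_on_diff continuous_on_add continuous_on_divide continuous_on_mult continuous_on_const
      continuous_on_real_sqrt continuous_on_id \<theta>_cont \<theta>'_cont f_cont dens_cont continuous_on_subset[OF h'_cont]) auto

lemma WR'_cont: "S \<subseteq> {0<..} \<Longrightarrow> continuous_on S WR'"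
  unfolding WR'_def[abs_def] v_def[abs_def]
  by (intro continuous_on_diff continuous_on_add continuous_on_divide continuous_on_mult continuous_on_const
      continuous_on_real_sqrt continuous_on_id \<theta>_cont \<theta>'_cont f_cont G_cont WL'_cont) auto

text \<open>The pointwise bounds multiplied by \<open>f x\<close> and rewritten in terms of the
  total derivatives.\<close>

lemma
  assumes x: "x > 0"
  shows N_le_left: "lam * x \<le> \<kappa> \<Longrightarrow> N x \<le> WL' x + KL x"
    and N_le_right: "G x \<ge> 0 \<Longrightarrow> \<tau> x * sqrt x * f x = G x \<Longrightarrow> N x \<le> WR' x + KR x"
proof -
  define p where "p = Z * f x / \<gamma> (U x) * sqrt x / sqrt (U x)"
  define q where "q = sqrt (U x) / sqrt x"
  define \<rho> where "\<rho> = sqrt x * (h' x * \<gamma> x / f x)"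
  have pos: "U x > 0" "\<gamma> (U x) > 0" using U_pos[OF x] dens_pos by auto
  have q: "q > 0" using pos x by (simp add: q_def)
  have \<theta>: "\<theta> x = 2 * sqrt x * (q - 1)" using x by (simp add: \<theta>_def q_def field_simps)
  have \<theta>': "sqrt x * \<theta>' x = p - 1" using x by (simp add: \<theta>'_def p_def field_simps)
  have v: "v x = 2 * (lam * x - \<kappa>) * (q - 1)" using x by (simp add: v_def \<theta>) (simp add: algebra_simps)
  have WL': "WL' x = f x * (r * (\<rho> * (2 * sqrt x * (q - 1)) + (p - 1) - 2 * (lam * x - \<kappa>) * (q - 1)))" if "f x > 0"
    using that unfolding WL'_def \<theta>' \<theta> v by (simp add: \<rho>_def field_simps)
  have ln_h: "ln (f x / \<gamma> x) = ln p - ln Z + 2 * \<kappa> * ln q - lam * x * (q\<^sup>2 - 1)" if "f x > 0"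
    using ln_density_ratio_transport[OF x pos(1) alpha_pos lam Z(1) that]
    by (simp add: p_def q_def \<kappa>_def)
  have p: "p > 0" if "f x > 0" using that pos x Z by (simp add: p_def)
  have fisher: "stein_fisher_integrand f \<alpha> lam x = \<rho>\<^sup>2" if "f x > 0"
    using fisher_eq[OF x that] by (simp add: \<rho>_def)
  \<comment> \<open>A zero of the density is treated separately: there both sides of either bound
    are 0.\<close>
  have zero: "f x = 0 \<or> f x > 0" using f_nonneg[OF x] by auto
  {
    assume k: "lam * x \<le> \<kappa>"
    show "N x \<le> WL' x + KL x"
    proof (cases "f x = 0")
      case False
      then have fx: "f x > 0" using zero by auto
      have "f x * ln (f x / \<gamma> x) \<le> f x * (r * (\<rho> * (2 * sqrt x * (q - 1)) + (p - 1) - 2 * (lam * x - \<kappa>) * (q - 1)) +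
          (r\<^sup>2 * \<rho>\<^sup>2 / lam + (r - 1 - ln r) * (1 + 2 * (\<kappa> - lam * x)) - ln Z))"
        unfolding ln_h[OF fx] using fx
        by (intro mult_left_mono transport_integrand_le_left lam x k r p q) auto
      then show ?thesis
        unfolding N_def WL'[OF fx] KL_def fisher[OF fx] cost_def by (simp add: algebra_simps)
    qed (use h'_eq_0[OF x] in \<open>simp add: N_def WL'_def KL_def\<close>)
  }
  {
    assume G: "G x \<ge> 0" "\<tau> x * sqrt x * f x = G x"
    show "N x \<le> WR' x + KR x"
    proof (cases "f x = 0")
      case False
      then have fx: "f x > 0" using zero by auto
      have "\<tau> x * (sqrt x * f x) \<ge> 0" using G by (simp add: mult.assoc)
      moreover have "sqrt x * f x > 0" using x fx by simp
      ultimately have tau: "\<tau> x \<ge> 0" by (simp add: zero_le_mult_iff)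
      have G\<theta>': "G x * \<theta>' x = f x * (\<tau> x * (p - 1))" by (simp add: G(2)[symmetric] \<theta>'[symmetric])
      have WR': "WR' x = f x * (r * (\<rho> * (2 * sqrt x * (q - 1)) + (p - 1) - 2 * (lam * x - \<kappa>) * (q - 1)) +
          (1 - r) * (\<tau> x * (p - 1) - 2 * (lam * x - \<kappa>) * (q - 1)))"
        unfolding WR'_def WL'[OF fx] G\<theta>' v by (simp add: algebra_simps)
      have "f x * ln (f x / \<gamma> x) \<le> f x * (r * (\<rho> * (2 * sqrt x * (q - 1)) + (p - 1) - 2 * (lam * x - \<kappa>) * (q - 1)) +
          (1 - r) * (\<tau> x * (p - 1) - 2 * (lam * x - \<kappa>) * (q - 1)) +
          (r\<^sup>2 * \<rho>\<^sup>2 / lam + (r - 1 - ln r) * (\<tau> x - 1)\<^sup>2 - ln Z))"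
        unfolding ln_h[OF fx] using fx
        by (intro mult_left_mono transport_integrand_le_nonneg_kernel lam x kappa_nonneg r p q tau) auto
      then show ?thesis
        unfolding N_def WR' KR_def fisher[OF fx] cost_def by (simp add: algebra_simps)
    qed (use h'_eq_0[OF x] G in \<open>simp add: N_def WR'_def WL'_def KR_def\<close>)
  }
qed

section \<open>Entropy bounds on compact intervals and their limit\<close>

lemma left_segment:
  assumes "0 < a" "a \<le> b" "lam * b \<le> \<kappa>"
  shows "set_integrable lborel {a..b} N"
    and "(LINT x:{a..b}|lborel. N x) \<le> WL b - WL a + (LINT x:{a..b}|lborel. KL x)"
proof -
  have KL: "set_integrable lborel {a..b} KL"
    unfolding KL_def[abs_def]
    by (intro set_integral_diff(1) set_integral_add(1) set_integrable_mult_right subinterval_int assms)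
  have L: "set_integrable lborel {a..b} (\<lambda>x. f x - \<gamma> x)"
    by (intro set_integral_diff(1) subinterval_int assms)
  have "AE x in lborel. x \<in> {a..b} \<longrightarrow> f x - \<gamma> x \<le> N x \<and> N x \<le> WL' x + KL x"
  proof (intro AE_I2 impI conjI)
    fix x assume x: "x \<in> {a..b}"
    then have "x > 0" "lam * x \<le> lam * b" using assms lam by auto
    then show "f x - \<gamma> x \<le> N x" "N x \<le> WL' x + KL x"
      using N_ge N_le_left[of x] assms by auto
  qed
  note * = set_integral_le_FTC[OF assms(2) _ WL_deriv WL'_cont KL L this]
  show "set_integrable lborel {a..b} N"
    by (rule *(1)) (use assms in \<open>auto simp: set_borel_measurable_def\<close>)
  show "(LINT x:{a..b}|lborel. N x) \<le> WL b - WL a + (LINT x:{a..b}|lborel. KL x)"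
    by (rule *(2)) (use assms in \<open>auto simp: set_borel_measurable_def\<close>)
qed

lemma right_segment:
  assumes "0 < a" "a \<le> b" and G: "\<And>x. x \<in> {a..b} \<Longrightarrow> G x \<ge> 0"
  shows "set_integrable lborel {a..b} N"
    and "(LINT x:{a..b}|lborel. N x) \<le> WR b - WR a + (LINT x:{a..b}|lborel. KR x)"
proof -
  have KR: "set_integrable lborel {a..b} KR"
    unfolding KR_def[abs_def]
    by (intro set_integral_diff(1) set_integral_add(1) set_integrable_mult_right subinterval_int assms)
  have L: "set_integrable lborel {a..b} (\<lambda>x. f x - \<gamma> x)"
    by (intro set_integral_diff(1) subinterval_int assms)
  have "AE x in lborel. x \<in> {a..b} \<longrightarrow> f x - \<gamma> x \<le> N x \<and> N x \<le> WR' x + KR x"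
    using G_AE
  proof (eventually_elim, intro impI conjI)
    fix x assume *: "x > 0 \<longrightarrow> \<tau> x * sqrt x * f x = G x" and x: "x \<in> {a..b}"
    then have "x > 0" using assms by auto
    then show "f x - \<gamma> x \<le> N x" "N x \<le> WR' x + KR x"
      using N_ge N_le_right[of x] G[OF x] * by auto
  qed
  note * = set_integral_le_FTC[OF assms(2) _ WR_deriv WR'_cont KR L this]
  show "set_integrable lborel {a..b} N"
    by (rule *(1)) (use assms in \<open>auto simp: set_borel_measurable_def\<close>)
  show "(LINT x:{a..b}|lborel. N x) \<le> WR b - WR a + (LINT x:{a..b}|lborel. KR x)"
    by (rule *(2)) (use assms in \<open>auto simp: set_borel_measurable_def\<close>)
qed

lemma LINT_K:
  assumes "0 < a"
  shows "(LINT x:{a..b}|lborel. KL x) = r\<^sup>2 / lam * (LINT x:{a..b}|lborel. f x * stein_fisher_integrand f \<alpha> lam x)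
      + cost * (LINT x:{a..b}|lborel. f x * (1 + 2 * (\<kappa> - lam * x))) - ln Z * (LINT x:{a..b}|lborel. f x)"
    and "(LINT x:{a..b}|lborel. KR x) = r\<^sup>2 / lam * (LINT x:{a..b}|lborel. f x * stein_fisher_integrand f \<alpha> lam x)
      + cost * (LINT x:{a..b}|lborel. f x * (\<tau> x - 1)\<^sup>2) - ln Z * (LINT x:{a..b}|lborel. f x)"
proof -
  note int = set_integral_add(1) set_integrable_mult_right subinterval_int[OF assms]
  show "(LINT x:{a..b}|lborel. KL x) = r\<^sup>2 / lam * (LINT x:{a..b}|lborel. f x * stein_fisher_integrand f \<alpha> lam x)
      + cost * (LINT x:{a..b}|lborel. f x * (1 + 2 * (\<kappa> - lam * x))) - ln Z * (LINT x:{a..b}|lborel. f x)"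
    unfolding KL_def
    by (subst set_integral_diff(2), intro int, intro int, subst set_integral_add(2), intro int, intro int,
        simp only: set_integral_mult_right)
  show "(LINT x:{a..b}|lborel. KR x) = r\<^sup>2 / lam * (LINT x:{a..b}|lborel. f x * stein_fisher_integrand f \<alpha> lam x)
      + cost * (LINT x:{a..b}|lborel. f x * (\<tau> x - 1)\<^sup>2) - ln Z * (LINT x:{a..b}|lborel. f x)"
    unfolding KR_def
    by (subst set_integral_diff(2), intro int, intro int, subst set_integral_add(2), intro int, intro int,
        simp only: set_integral_mult_right)
qed

text \<open>All three coefficients are nonnegative; for \<open>- ln Z\<close> this is
  \<open>Z \<le> 1\<close>.\<close>

lemma weighted_sum_le:
  assumes "j \<le> J" "s \<le> discr" "m \<le> 1"
  shows "r\<^sup>2 / lam * j + cost * s - ln Z * m \<le> r\<^sup>2 / lam * J + cost * discr - ln Z"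
proof -
  have "r\<^sup>2 / lam * j \<le> r\<^sup>2 / lam * J" "cost * s \<le> cost * discr"
    using assms lam cost_nonneg by (auto intro!: mult_left_mono divide_right_mono)
  moreover have "- ln Z * m \<le> - ln Z * 1"
    using assms Z by (intro mult_left_mono) auto
  ultimately show ?thesis by simp
qed

lemma \<theta>_sign:
  assumes "x > 0"
  shows "x \<le> c \<Longrightarrow> \<theta> x \<ge> 0" "d \<le> x \<Longrightarrow> \<theta> x \<le> 0"
  using U_range[OF assms] by (auto simp: \<theta>_def)

lemma truncated_entropy_le:
  obtains A B where "A > 0" "\<And>a b. 0 < a \<Longrightarrow> a < A \<Longrightarrow> B < b \<Longrightarrow> set_integrable lborel {a..b} N \<and>
     (LINT x:{a..b}|lborel. N x) \<le> r\<^sup>2 / lam * J + cost * discr - ln Z"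
proof (rule G_sign_change)
  assume G: "\<And>x. x > 0 \<Longrightarrow> G x \<ge> 0"
  show thesis
  proof (rule that[of c d])
    fix a b assume ab: "0 < a" "a < c" "d < b"
    then have "a \<le> b" "b > 0" using cd by auto
    note seg = right_segment[OF ab(1) \<open>a \<le> b\<close> G]
    have "WR b \<le> 0"
      unfolding WR_def WL_def using \<theta>_sign(2)[of b] ab \<open>b > 0\<close> r f_nonneg[of b] G[of b]
      by (intro add_nonpos_nonpos mult_nonneg_nonpos mult_nonneg_nonneg) auto
    moreover have "0 \<le> WR a"
      unfolding WR_def WL_def using \<theta>_sign(1)[of a] ab r f_nonneg[of a] G[of a]
      by (intro add_nonneg_nonneg mult_nonneg_nonneg) auto
    moreover have "(LINT x:{a..b}|lborel. KR x) \<le> r\<^sup>2 / lam * J + cost * discr - ln Z"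
      unfolding LINT_K(2)[OF ab(1)] by (intro weighted_sum_le subinterval_bounds ab)
    ultimately show "set_integrable lborel {a..b} N \<and>
     (LINT x:{a..b}|lborel. N x) \<le> r\<^sup>2 / lam * J + cost * discr - ln Z"
      using seg ab by force
  qed (use cd in auto)
next
  fix x0 assume x0: "x0 > 0" "lam * x0 \<le> \<kappa>" "G x0 = 0"
    "\<And>x. 0 < x \<Longrightarrow> x \<le> x0 \<Longrightarrow> G x \<le> 0" "\<And>x. x0 \<le> x \<Longrightarrow> G x \<ge> 0"
  show thesis
  proof (rule that[of "min c x0" "max d x0"])
    fix a b assume "0 < a" "a < min c x0" "max d x0 < b"
    then have ab: "0 < a" "a < c" "a \<le> x0" "d < b" "x0 \<le> b" by auto
    note left = left_segment[OF ab(1,3) x0(2)]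
    note right = right_segment[OF x0(1) ab(5) x0(5)]
    have N: "set_integrable lborel {a..b} N"
      "(LINT x:{a..b}|lborel. N x) = (LINT x:{a..x0}|lborel. N x) + (LINT x:{x0..b}|lborel. N x)"
      using set_integral_Icc_split[OF ab(3,5) left(1) right(1)] by auto
    have "WR b \<le> 0"
      unfolding WR_def WL_def using \<theta>_sign(2)[of b] ab x0(1,5) r f_nonneg[of b]
      by (intro add_nonpos_nonpos mult_nonneg_nonpos mult_nonneg_nonneg) auto
    moreover have "0 \<le> WL a"
      unfolding WL_def using \<theta>_sign(1)[of a] ab r f_nonneg[of a]
      by (intro mult_nonneg_nonneg) auto
    \<comment> \<open>The inner boundary terms cancel because \<open>G\<close> vanishes at
      \<open>x0\<close>.\<close>
    moreover have "WR x0 = WL x0" by (simp add: WR_def x0(3))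
    ultimately have "(LINT x:{a..b}|lborel. N x) \<le> (LINT x:{a..x0}|lborel. KL x) + (LINT x:{x0..b}|lborel. KR x)"
      using N(2) left(2) right(2) by force
    also have "\<dots> = r\<^sup>2 / lam * ((LINT x:{a..x0}|lborel. f x * stein_fisher_integrand f \<alpha> lam x) + (LINT x:{x0..b}|lborel. f x * stein_fisher_integrand f \<alpha> lam x))
       + cost * ((LINT x:{a..x0}|lborel. f x * (1 + 2 * (\<kappa> - lam * x))) + (LINT x:{x0..b}|lborel. f x * (\<tau> x - 1)\<^sup>2))
       - ln Z * ((LINT x:{a..x0}|lborel. f x) + (LINT x:{x0..b}|lborel. f x))"
      unfolding LINT_K(1)[OF ab(1)] LINT_K(2)[OF x0(1)] by (simp add: distrib_left)
    also have "\<dots> \<le> r\<^sup>2 / lam * J + cost * discr - ln Z"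
    proof (rule weighted_sum_le)
      \<comment> \<open>\<open>left_kernel_cost\<close> needs kernel mass down to
        \<open>a/4\<close>, which is still covered by the total discrepancy.\<close>
      have a4: "0 < a / 4" "a / 4 \<le> x0" using ab by auto
      have "(LINT x:{a..x0}|lborel. f x * (1 + 2 * (\<kappa> - lam * x))) + (LINT x:{x0..b}|lborel. f x * (\<tau> x - 1)\<^sup>2)
         \<le> (LINT x:{a/4..x0}|lborel. f x * (\<tau> x - 1)\<^sup>2) + (LINT x:{x0..b}|lborel. f x * (\<tau> x - 1)\<^sup>2)"
        using left_kernel_cost[OF x0(2-4) ab(1,3)] by simp
      also have "\<dots> = (LINT x:{a/4..b}|lborel. f x * (\<tau> x - 1)\<^sup>2)"
        by (intro set_integral_Icc_split(2)[symmetric] a4 ab subinterval_int x0)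
      also have "\<dots> \<le> discr" by (rule subinterval_bounds[OF a4(1)])
      finally show "(LINT x:{a..x0}|lborel. f x * (1 + 2 * (\<kappa> - lam * x))) + (LINT x:{x0..b}|lborel. f x * (\<tau> x - 1)\<^sup>2) \<le> discr" .
    qed (use subinterval_bounds[OF ab(1), of b] set_integral_Icc_split(2)[OF ab(3,5) subinterval_int(1)[OF ab(1)] subinterval_int(1)[OF x0(1)]]
        set_integral_Icc_split(2)[OF ab(3,5) subinterval_int(2)[OF ab(1)] subinterval_int(2)[OF x0(1)]] in auto)
    finally show "set_integrable lborel {a..b} N \<and>
     (LINT x:{a..b}|lborel. N x) \<le> r\<^sup>2 / lam * J + cost * discr - ln Z" using N(1) by simp
  qed (use cd x0 in auto)
qed

text \<open>\<open>N\<close> changes sign, so the limit is taken for the nonnegative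
  \<open>N - f + \<gamma>\<close>. The correction integrates to zero in the end because
  \<open>f\<close> and \<open>\<gamma>\<close> both have mass 1.\<close>

lemma entropy_le_transport:
  shows "set_integrable lborel {0<..} N"
    and "(LINT x:{0<..}|lborel. N x) \<le> r\<^sup>2 / lam * J + cost * discr - ln Z"
proof -
  define D where "D = r\<^sup>2 / lam * J + cost * discr - ln Z"
  obtain A B where A: "A > 0" and AB: "\<And>a b. 0 < a \<Longrightarrow> a < A \<Longrightarrow> B < b \<Longrightarrow>
      set_integrable lborel {a..b} N \<and> (LINT x:{a..b}|lborel. N x) \<le> D"
    using truncated_entropy_le unfolding D_def by metis
  \<comment> \<open>With this offset every interval of the exhaustion lies in the range where the
    truncated bound holds.\<close>
  obtain m :: nat where m: "real m > max B (inverse A)" using reals_Archimedean2 by blast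
  define I where "I n = {inverse (real (Suc (n + m)))..real (Suc (n + m))}" for n
  have I_N: "set_integrable lborel (I n) N" "(LINT x:I n|lborel. N x) \<le> D" for n
  proof -
    have "inverse A < real (Suc (n + m))" "B < real (Suc (n + m))" using m by auto
    moreover from this have "inverse (real (Suc (n + m))) < A"
      using A by (metis inverse_inverse_eq inverse_positive_iff_positive less_imp_inverse_less)
    ultimately show "set_integrable lborel (I n) N" "(LINT x:I n|lborel. N x) \<le> D"
      using AB[of "inverse (real (Suc (n + m)))" "real (Suc (n + m))"] by (auto simp: I_def)
  qed
  have I_sub: "I n \<subseteq> {0<..}" for n unfolding I_def by (rule reciprocal_Icc_subset)
  have I_mono: "incseq I" unfolding I_def[abs_def] by (rule incseq_reciprocal_Icc)
  have I_UN: "(\<Union>n. I n) = {0<..}" unfolding I_def by (rule UN_reciprocal_Icc)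
  have dens_int: "set_integrable lborel {0<..} \<gamma>" and dens_one: "(LINT x:{0<..}|lborel. \<gamma> x) = 1"
    using set_integrable_gamma_dens[OF alpha_pos lam] by auto
  have I_meas: "I n \<in> sets lborel" for n by (simp add: I_def)
  have sub: "set_integrable lborel (I n) f" "set_integrable lborel (I n) \<gamma>" for n
    by (rule set_integrable_subset[OF _ I_meas I_sub], rule f_int dens_int)+
  define M where "M x = N x - f x + \<gamma> x" for x
  have M_int: "set_integrable lborel (I n) M" for n
    unfolding M_def[abs_def] by (intro set_integral_add(1) set_integral_diff(1) I_N sub)
  have M_nonneg: "M x \<ge> 0" if "x > 0" for x
    using N_ge[OF that] by (simp add: M_def)
  have M_le: "(LINT x:I n|lborel. M x) \<le> D - (LINT x:I n|lborel. f x) + 1" for n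
  proof -
    have "(LINT x:I n|lborel. M x) = (LINT x:I n|lborel. N x) - (LINT x:I n|lborel. f x) + (LINT x:I n|lborel. \<gamma> x)"
      unfolding M_def by (simp add: I_N sub)
    moreover have "(LINT x:I n|lborel. \<gamma> x) \<le> (LINT x:{0<..}|lborel. \<gamma> x)"
      by (rule set_integral_mono_subset[OF dens_int I_meas I_sub]) (auto intro: less_imp_le dens_pos)
    ultimately show ?thesis using I_N(2)[of n] dens_one by simp
  qed
  have "incseq (\<lambda>n. LINT x:I n|lborel. M x)"
  proof (rule incseq_SucI)
    fix n
    show "(LINT x:I n|lborel. M x) \<le> (LINT x:I (Suc n)|lborel. M x)"
    proof (rule set_integral_mono_subset[OF M_int I_meas])
      show "I n \<subseteq> I (Suc n)" using I_mono by (simp add: incseq_SucD)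
      show "M x \<ge> 0" if "x \<in> I (Suc n)" for x using M_nonneg[of x] I_sub that by auto
    qed
  qed
  moreover have "(LINT x:I n|lborel. M x) \<le> D + 1" for n
  proof -
    have "0 \<le> (LINT x:I n|lborel. f x)"
      unfolding set_lebesgue_integral_def using f_nonneg I_sub
      by (intro Bochner_Integration.integral_nonneg) (auto simp: indicator_def subset_eq)
    then show ?thesis using M_le[of n] by linarith
  qed
  ultimately obtain L where "(\<lambda>n. LINT x:I n|lborel. M x) \<longlonglongrightarrow> L"
    using incseq_convergent by blast
  then have M: "set_integrable lborel {0<..} M"
    unfolding I_UN[symmetric] using M_nonneg I_sub
    by (intro pos_integrable_to_top I_meas M_int) (auto simp: I_mono subset_eq)
  have lim: "(\<lambda>n. LINT x:I n|lborel. g x) \<longlonglongrightarrow> (LINT x:{0<..}|lborel. g x)"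
    if "set_integrable lborel {0<..} g" for g :: "real \<Rightarrow> real"
    unfolding I_UN[symmetric] using that
    by (intro set_integral_cont_up I_meas I_mono) (simp add: I_UN)
  have "(\<lambda>n. D - (LINT x:I n|lborel. f x) + 1) \<longlonglongrightarrow> D - (LINT x:{0<..}|lborel. f x) + 1"
    by (intro tendsto_intros lim f_int)
  then have "(LINT x:{0<..}|lborel. M x) \<le> D - (LINT x:{0<..}|lborel. f x) + 1"
    using M_le by (intro LIMSEQ_le[OF lim[OF M]]) blast+
  then have M_D: "(LINT x:{0<..}|lborel. M x) \<le> D" by (simp add: f_one)
  have N_eq: "N = (\<lambda>x. M x + f x - \<gamma> x)" by (auto simp: M_def)
  show "set_integrable lborel {0<..} N"
    unfolding N_eq by (intro set_integral_add(1) set_integral_diff(1) M f_int dens_int)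
  have "(LINT x:{0<..}|lborel. N x) = (LINT x:{0<..}|lborel. M x)"
    unfolding N_eq using M f_int dens_int by (simp add: f_one dens_one)
  with M_D show "(LINT x:{0<..}|lborel. N x) \<le> r\<^sup>2 / lam * J + cost * discr - ln Z"
    by (simp add: D_def)
qed

end

section \<open>Removing the truncation and choosing \<open>r\<close>\<close>

context gamma_stein
begin

text \<open>Each compact interval gives its own transport map. The price of conditioning is
  \<open>- ln (Z n)\<close>, which tends to 0 as the intervals exhaust the half-line.\<close>

lemma entropy_le:
  assumes r: "0 < r" "r \<le> 1"
  shows "set_integrable lborel {0<..} N"
    and "(LINT x:{0<..}|lborel. N x) \<le> r\<^sup>2 / lam * J + (r - 1 - ln r) * discr"
proof -
  \<comment> \<open>The offset 1 makes already the first interval nondegenerate; without it,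
    \<open>n = 0\<close> would give the single point 1.\<close>
  define I where "I n = {inverse (real (Suc (n + 1)))..real (Suc (n + 1))}" for n
  define Z where "Z n = (LINT x:I n|lborel. \<gamma> x)" for n
  have dens_int: "set_integrable lborel {0<..} \<gamma>" and dens_one: "(LINT x:{0<..}|lborel. \<gamma> x) = 1"
    using set_integrable_gamma_dens[OF alpha_pos lam] by auto
  have cd: "0 < inverse (real (Suc (n + 1)))" "inverse (real (Suc (n + 1))) < real (Suc (n + 1))" for n
  proof -
    show "0 < inverse (real (Suc (n + 1)))" by simp
    have "inverse (real (Suc (n + 1))) < 1" by (rule inverse_less_1_iff[THEN iffD2]) auto
    then show "inverse (real (Suc (n + 1))) < real (Suc (n + 1))" by simp
  qed
  have I_sub: "I n \<subseteq> {0<..}" for n unfolding I_def by (rule reciprocal_Icc_subset)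
  have Z_le: "Z n \<le> 1" for n
    unfolding Z_def dens_one[symmetric] using dens_pos
    by (intro set_integral_mono_subset[OF dens_int] I_sub) (auto simp: I_def less_imp_le)
  have Z_pos: "Z n > 0" for n
  proof -
    obtain P where P: "\<And>x. x > 0 \<Longrightarrow> (P has_real_derivative \<gamma> x) (at x)"
      using antiderivative_on_pos[OF dens_cont[OF order_refl]] by blast
    have "Z n = P (real (Suc (n + 1))) - P (inverse (real (Suc (n + 1))))"
      unfolding Z_def I_def
      by (intro set_integral_FTC dens_cont[OF I_sub[unfolded I_def]] less_imp_le[OF cd(2)] P
          order_less_le_trans[OF cd(1)])
    moreover have "P (inverse (real (Suc (n + 1)))) < P (real (Suc (n + 1)))"
    proof (rule DERIV_pos_imp_increasing[where f = P, OF cd(2)])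
      fix x assume "inverse (real (Suc (n + 1))) \<le> x"
      then have "x > 0" using cd(1)[of n] by linarith
      then show "\<exists>y. (P has_real_derivative y) (at x) \<and> 0 < y" using P dens_pos by blast
    qed
    ultimately show ?thesis by simp
  qed
  have step: "set_integrable lborel {0<..} N \<and>
      (LINT x:{0<..}|lborel. N x) \<le> r\<^sup>2 / lam * J + (r - 1 - ln r) * discr - ln (Z n)" for n
  proof -
    obtain U where U: "\<And>x. x > 0 \<Longrightarrow> U x \<in> {inverse (real (Suc (n + 1)))..real (Suc (n + 1))}"
      "\<And>x. x > 0 \<Longrightarrow> (U has_real_derivative Z n * f x / \<gamma> (U x)) (at x)"
      unfolding Z_def I_def
      by (rule monotone_transport_map[OF dens_cont[OF order_refl] dens_pos f_cont[OF order_refl] f_nonneg f_int f_one cd])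
        blast+
    interpret gamma_transport \<alpha> lam f \<tau> h' G "inverse (real (Suc (n + 1)))" "real (Suc (n + 1))" r "Z n" U
      by unfold_locales (use cd r Z_pos Z_le U in auto)
    show ?thesis using entropy_le_transport by (simp add: cost_def)
  qed
  then show "set_integrable lborel {0<..} N" by blast
  have "Z \<longlonglongrightarrow> 1"
  proof -
    have UN: "(\<Union>n. I n) = {0<..}" unfolding I_def by (rule UN_reciprocal_Icc)
    have "incseq I" unfolding I_def[abs_def] by (rule incseq_reciprocal_Icc)
    then have "(\<lambda>n. LINT x:I n|lborel. \<gamma> x) \<longlonglongrightarrow> (LINT x:(\<Union>n. I n)|lborel. \<gamma> x)"
      using dens_int by (intro set_integral_cont_up) (simp_all add: UN, simp add: I_def)
    then show ?thesis by (simp add: UN dens_one Z_def[abs_def])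
  qed
  then have "(\<lambda>n. r\<^sup>2 / lam * J + (r - 1 - ln r) * discr - ln (Z n)) \<longlonglongrightarrow> r\<^sup>2 / lam * J + (r - 1 - ln r) * discr - ln 1"
    by (intro tendsto_intros) auto
  then show "(LINT x:{0<..}|lborel. N x) \<le> r\<^sup>2 / lam * J + (r - 1 - ln r) * discr"
    using step by (intro LIMSEQ_le_const) auto
qed

lemma entropy_le_log:
  "(LINT x:{0<..}|lborel. N x) \<le> 1/2 * discr * ln (1 + 2 / lam * (J / discr))"
proof -
  have J: "J \<ge> 0"
    unfolding J_def set_lebesgue_integral_def using fisher_nonneg
    by (intro Bochner_Integration.integral_nonneg) (auto simp: indicator_def)
  have discr: "discr \<ge> 0"
    unfolding discr_def set_lebesgue_integral_def using f_nonneg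
    by (intro Bochner_Integration.integral_nonneg) (auto simp: indicator_def)
  show ?thesis
  proof (cases "discr = 0")
    case True
    \<comment> \<open>With zero discrepancy only the Fisher term remains, and letting
      \<open>r\<close> tend to 0 removes it. The claimed bound is 0 here, whatever the quotient by
      zero means.\<close>
    have "(\<lambda>n. (inverse (real (Suc n)))\<^sup>2 / lam * J) \<longlonglongrightarrow> 0\<^sup>2 / lam * J"
      using lam by (intro tendsto_intros LIMSEQ_inverse_real_of_nat) auto
    moreover have "(LINT x:{0<..}|lborel. N x) \<le> (inverse (real (Suc n)))\<^sup>2 / lam * J" for n
      using entropy_le(2)[of "inverse (real (Suc n))"] True by (simp add: inverse_le_1_iff)
    ultimately have "(LINT x:{0<..}|lborel. N x) \<le> 0\<^sup>2 / lam * J"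
      by (intro LIMSEQ_le_const) auto
    then show ?thesis using True by simp
  next
    case False
    then have S: "discr > 0" using discr by simp
    define t where "t = 1 + 2 / lam * (J / discr)"
    have t: "t \<ge> 1" using J S lam by (simp add: t_def)
    define r where "r = 1 / sqrt t"
    have r: "0 < r" "r \<le> 1" using t by (auto simp: r_def)
    have r2: "r\<^sup>2 = 1 / t" using t by (simp add: r_def power_divide)
    have ln_r: "ln r = - (ln t / 2)" using t by (simp add: r_def ln_div ln_sqrt)
    have "J / lam = (t - 1) / 2 * discr" using S lam by (simp add: t_def field_simps)
    then have "r\<^sup>2 / lam * J = r\<^sup>2 * ((t - 1) / 2 * discr)" by (metis times_divide_eq_left times_divide_eq_right)
    also have "\<dots> = (1 - r\<^sup>2) / 2 * discr" using t by (simp add: r2 field_simps)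
    finally have *: "r\<^sup>2 / lam * J = (1 - r\<^sup>2) / 2 * discr" .
    have "(LINT x:{0<..}|lborel. N x) \<le> (1 - r\<^sup>2) / 2 * discr + (r - 1 - ln r) * discr"
      using entropy_le(2)[OF r] unfolding * .
    \<comment> \<open>For \<open>r = 1 / sqrt t\<close> the terms without logarithm combine to a
      negative square, which is then dropped.\<close>
    also have "\<dots> = (ln t / 2 - (1 - r)\<^sup>2 / 2) * discr"
      by (simp add: ln_r power2_eq_square field_simps)
    also have "\<dots> \<le> ln t / 2 * discr" using S by (intro mult_right_mono) auto
    finally show ?thesis by (simp add: t_def mult.commute)
  qed
qed

end

section \<open>From the Stein identity to the entropy bound\<close>

text \<open>The integrability conjunct gives the entropy bound its meaning, since the integral of a
  non-integrable function is 0 by convention. For zero discrepancy the right side is 0.\<close>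

theorem theorem6p1:
  fixes \<alpha> lam :: real and f \<tau> :: "real \<Rightarrow> real"
  assumes "\<alpha> \<ge> 1/2" and "lam > 0"
    and f_meas: "f \<in> borel_measurable borel"
    and f_nonneg: "\<And>u. u > 0 \<Longrightarrow> f u \<ge> 0"
    and f_dens: "expect_finite f (\<lambda>_. 1)" "expect f (\<lambda>_. 1) = 1"
    and C2: "C2_on {0<..} (\<lambda>u. f u / gamma_dens \<alpha> lam u)"
    and moment: "expect_finite f (\<lambda>u. u powr (\<alpha> + 4))"
    and mean: "expect f (\<lambda>u. u) = \<alpha> / lam"
    and fisher: "expect_finite f (stein_fisher_integrand f \<alpha> lam)"
    and kernel: "is_stein_kernel f \<alpha> lam \<tau>"
    and kernel_L2: "expect_finite f (\<lambda>u. (\<tau> u - 1)\<^sup>2)"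
  shows "set_integrable lborel {0<..} (\<lambda>u. f u * ln (f u / gamma_dens \<alpha> lam u)) \<and>
         rel_entropy_gamma f \<alpha> lam \<le>
           1/2 * expect f (\<lambda>u. (\<tau> u - 1)\<^sup>2) *
           ln (1 + (2 / lam) * (J_st_gamma f \<alpha> lam / expect f (\<lambda>u. (\<tau> u - 1)\<^sup>2)))"
proof -
  obtain h' h'' where h: "\<And>x. x > 0 \<Longrightarrow> ((\<lambda>u. f u / gamma_dens \<alpha> lam u) has_real_derivative h' x) (at x)"
    "\<And>x. x > 0 \<Longrightarrow> (h' has_real_derivative h'' x) (at x)"
    using C2 unfolding C2_on_def by auto
  have alpha_pos: "\<alpha> > 0" using assms(1) by simp
  have f_int: "set_integrable lborel {0<..} f" and f_one: "(LINT u:{0<..}|lborel. f u) = 1"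
    using f_dens by (simp_all add: expect_finite_def expect_def)
  have tau_meas: "\<tau> \<in> borel_measurable borel" using kernel by (simp add: is_stein_kernel_def)
  have tau_int: "set_integrable lborel {0<..} (\<lambda>u. f u * (\<tau> u - 1)\<^sup>2)"
    using kernel_L2 by (simp add: expect_finite_def)
  note tau_f = set_integrable_kernel_times_density[OF f_meas tau_meas f_nonneg f_int tau_int]
  have f_cont: "continuous_on {0<..} f"
  proof -
    have "continuous_on {0<..} (\<lambda>u. f u / gamma_dens \<alpha> lam u * gamma_dens \<alpha> lam u)"
      by (intro continuous_on_mult continuous_at_imp_continuous_on ballI DERIV_isCont[OF h(1)]
          DERIV_isCont[OF gamma_dens_has_derivative]) auto
    moreover have "f u / gamma_dens \<alpha> lam u * gamma_dens \<alpha> lam u = f u" if "u \<in> {0<..}" for u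
      using gamma_dens_pos[OF alpha_pos assms(2), of u] that by simp
    ultimately show ?thesis by (rule continuous_on_eq)
  qed
  \<comment> \<open>Read weakly, the Stein identity says that \<open>w\<close> has derivative
    \<open>g\<close>. As \<open>g\<close> is continuous, \<open>w\<close> agrees almost everywhere
    with a differentiable function.\<close>
  define w g where "w u = \<tau> u * sqrt u * f u" and "g u = (\<alpha> - 1/2 - lam * u) / sqrt u * f u" for u
  obtain G where G: "\<And>x. x > 0 \<Longrightarrow> (G has_real_derivative g x) (at x)"
    "AE x in lborel. x > 0 \<longrightarrow> w x = G x"
  proof (rule antiderivative_if_weak_antiderivative[of w g])
    show "set_integrable lborel {a..b} w" if "0 < a" for a b
    proof (rule set_integrable_bound)
      show "set_integrable lborel {a..b} (\<lambda>u. sqrt b * (\<tau> u * f u))"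
        by (intro set_integrable_mult_right set_integrable_subset[OF tau_f]) (use that in auto)
      show "set_borel_measurable lborel {a..b} w"
        unfolding set_borel_measurable_def w_def using f_meas tau_meas by measurable
      show "AE u in lborel. u \<in> {a..b} \<longrightarrow> norm (w u) \<le> norm (sqrt b * (\<tau> u * f u))"
      proof (intro AE_I2 impI)
        fix u assume u: "u \<in> {a..b}"
        then have "\<bar>sqrt u\<bar> * \<bar>\<tau> u * f u\<bar> \<le> \<bar>sqrt b\<bar> * \<bar>\<tau> u * f u\<bar>"
          using that by (intro mult_right_mono) auto
        then show "norm (w u) \<le> norm (sqrt b * (\<tau> u * f u))"
          by (simp add: w_def abs_mult mult_ac)
      qed
    qed
    show "continuous_on {0<..} g"
      unfolding g_def[abs_def]
      by (intro continuous_on_mult continuous_on_divide continuous_on_diff continuous_on_const continuous_on_id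
          continuous_on_real_sqrt f_cont) auto
    fix \<psi> \<psi>' :: "real \<Rightarrow> real" and a b :: real
    assume ab: "0 < a" "a < b" and d: "\<And>x. (\<psi> has_real_derivative \<psi>' x) (at x)"
      and smooth: "\<And>n. smooth_upto n UNIV \<psi>" and supp: "\<And>x. x \<notin> {a..b} \<Longrightarrow> \<psi> x = 0 \<and> \<psi>' x = 0"
    \<comment> \<open>Chosen so that \<open>sqrt x * \<phi> x\<close> is \<open>\<psi> x\<close> on
      the half-line. The power form lets \<open>smooth_upto_powr\<close> apply; for
      \<open>x \<le> 0\<close> the function vanishes because \<open>\<psi>\<close> does.\<close>
    define \<phi> where "\<phi> x = x powr (- (1/2)) * \<psi> x" for x
    have \<phi>: "\<phi> x = \<psi> x / sqrt x" if "x > 0" for x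
    proof -
      have "x powr (- (1/2)) = inverse (sqrt x)"
        unfolding powr_minus powr_half_sqrt[OF less_imp_le[OF that]] ..
      then show ?thesis by (simp only: \<phi>_def divide_inverse mult.commute)
    qed
    have "test_fun \<phi>"
      unfolding test_fun_def
    proof (intro conjI allI impI)
      have "smooth_upto n {0<..} \<phi>" for n
        unfolding \<phi>_def[abs_def]
        by (rule smooth_upto_mult[OF smooth_upto_powr smooth_upto_subset[OF smooth subset_UNIV]])
      then show "((deriv ^^ k) \<phi>) differentiable (at x)" if "x > 0" for k x
        by (rule smooth_upto_differentiable_iterated_deriv) (use that in auto)
      show "\<exists>a b. 0 < a \<and> a \<le> b \<and> (\<forall>x. x \<notin> {a..b} \<longrightarrow> \<phi> x = 0)"
        using ab supp by (intro exI[of _ a] exI[of _ b]) (auto simp: \<phi>_def)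
    qed
    then have eq: "expect f (\<lambda>x. (lam * x - \<alpha> + 1/2) * \<phi> x) =
        expect f (\<lambda>x. \<tau> x * sqrt x * deriv (\<lambda>y. sqrt y * \<phi> y) x)"
      using kernel by (simp add: is_stein_kernel_def)
    have dv: "deriv (\<lambda>y. sqrt y * \<phi> y) x = \<psi>' x" if "x > 0" for x
    proof (rule DERIV_imp_deriv)
      show "((\<lambda>y. sqrt y * \<phi> y) has_real_derivative \<psi>' x) (at x)"
        by (rule has_field_derivative_transform_within_open[OF d, where S = "{0<..}"]) (use that \<phi> in auto)
    qed
    have "expect f (\<lambda>x. (lam * x - \<alpha> + 1/2) * \<phi> x) = (LINT x:{a..b}|lborel. - (g x * \<psi> x))"
      unfolding expect_def set_lebesgue_integral_def
    proof (intro Bochner_Integration.integral_cong refl)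
      fix x
      show "indicator {0<..} x *\<^sub>R (f x * ((lam * x - \<alpha> + 1/2) * \<phi> x)) = indicator {a..b} x *\<^sub>R - (g x * \<psi> x)"
      proof (cases "x \<in> {a..b}")
        case True
        then have "x > 0" using ab by auto
        then show ?thesis using True by (simp add: g_def \<phi>) (simp add: field_simps)
      next
        case False
        then show ?thesis using supp[of x] by (simp add: \<phi>_def)
      qed
    qed
    also have "\<dots> = - (LINT x:{a..b}|lborel. g x * \<psi> x)"
      by (simp add: set_lebesgue_integral_def)
    finally have 1: "expect f (\<lambda>x. (lam * x - \<alpha> + 1/2) * \<phi> x) = - (LINT x:{a..b}|lborel. g x * \<psi> x)" .
    have "expect f (\<lambda>x. \<tau> x * sqrt x * deriv (\<lambda>y. sqrt y * \<phi> y) x) = (LINT x:{a..b}|lborel. w x * \<psi>' x)"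
      unfolding expect_def set_lebesgue_integral_def
    proof (intro Bochner_Integration.integral_cong refl)
      fix x
      show "indicator {0<..} x *\<^sub>R (f x * (\<tau> x * sqrt x * deriv (\<lambda>y. sqrt y * \<phi> y) x)) = indicator {a..b} x *\<^sub>R (w x * \<psi>' x)"
      proof (cases "x > 0")
        case True
        then show ?thesis using supp[of x] dv[of x] by (auto simp: w_def indicator_def)
      next
        case False
        then show ?thesis using ab by (auto simp: indicator_def)
      qed
    qed
    with 1 eq show "(LINT x:{a..b}|lborel. g x * \<psi> x) = - (LINT x:{a..b}|lborel. w x * \<psi>' x)" by simp
  qed (rule that)
  interpret gamma_stein \<alpha> lam f \<tau> h' G
  proof unfold_locales
    show "continuous_on {0<..} h'"
      by (intro continuous_at_imp_continuous_on ballI DERIV_isCont[OF h(2)]) simp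
    show "set_integrable lborel {0<..} (\<lambda>u. f u * stein_fisher_integrand f \<alpha> lam u)"
      using fisher by (simp add: expect_finite_def)
    show "AE u in lborel. u > 0 \<longrightarrow> \<tau> u * sqrt u * f u = G u"
      using G(2) by (simp add: w_def)
    show "(G has_real_derivative (\<alpha> - 1/2 - lam * u) / sqrt u * f u) (at u)" if "u > 0" for u
      using G(1)[OF that] by (simp add: g_def)
  qed (use assms h(1) f_int f_one tau_meas tau_int in auto)
  \<comment> \<open>Integrability does not involve \<open>r\<close>, so any admissible value
    serves.\<close>
  have "set_integrable lborel {0<..} N" by (rule entropy_le(1)[of 1]) auto
  with entropy_le_log show ?thesis
    unfolding rel_entropy_gamma_def J_st_gamma_def expect_def J_def[symmetric] discr_def[symmetric] N_def[abs_def]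
    by simp
qed

end
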